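(* Let $\gamma \equiv \gamma^{(6)} = \{\gamma_{ij}\}_{i,j \geq 0,\ i+j\leq 6}$ be a collection of complex numbers with $\gamma_{00}>0$ and $\gamma_{ji}=\overline{\gamma_{ij}}$, with associated moment matrices $M(3)$ and $M(2)$ and Riesz functional $\Lambda$. Let $u,t\in\mathbb{R}$ satisfy $0<|u|<t<2|u|$, and let $$q_7(z,\bar z):=z^3-itz-u\bar z,\qquad q_{LC}(z,\bar z):=i(z-i\bar z)(\bar z z-u).$$ Assume that $M(3)\geq 0$, that $M(2)>0$, and that $q_7(Z,\bar Z)=0$ in the column space of $M(3)$. Then the following statements are equivalent. (i) There exists a representing measure for $M(3)$ (that is, for $\gamma^{(6)}$). (ii) $\Lambda(q_{LC})=0$ and $\Lambda(z\,q_{LC})=0$. (iii) $\operatorname{Re}\gamma_{12}-\operatorname{Im}\gamma_{12}=u(\operatorname{Re}\gamma_{01}-\operatorname{Im}\gamma_{01})$ and $\gamma_{22}=(t+u)\gamma_{11}-2u\operatorname{Im}\gamma_{02}$. (iv) $q_{LC}(Z,\bar Z)\equiv \bar Z^2Z+i\bar ZZ^2-u\bar Z-iuZ=0$ in the column space of $M(3)$.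
   Context: A representing measure for $\gamma^{(2n)}=\{\gamma_{ij}\}_{i+j\leq 2n}$ is a positive Borel measure $\mu$ on $\mathbb{C}$ with $\gamma_{ij}=\int \bar z^i z^j\,d\mu$ for all $0\leq i+j\leq 2n$. The Riesz functional $\Lambda$ is the linear functional on polynomials in $z,\bar z$ of total degree at most $2n$ given by $\Lambda\big(\sum a_{ij}\bar z^iz^j\big)=\sum a_{ij}\gamma_{ij}$. The moment matrix $M(n)$ has rows and columns labeled by the monomials of degree at most $n$ in the order $1,Z,\bar Z,Z^2,\bar ZZ,\bar Z^2,\ldots,Z^n,\bar Z Z^{n-1},\ldots,\bar Z^n$; the entry in row $\bar Z^kZ^l$ and column $\bar Z^iZ^j$ is $\gamma_{i+l,\,j+k}$. Equivalently, $\langle M(n)\hat f,\hat g\rangle=\Lambda(f\bar g)$ for polynomials $f,g$ of degree at most $n$, where $\hat f$ is the coefficient vector of $f$. $M(2)$ is the moment matrix of the moments $\gamma_{ij}$ with $i+j\leq 4$, i.e. the leading $6\times 6$ principal block of the $10\times 10$ matrix $M(3)$. $M\geq 0$ means positive semidefinite, and $M>0$ means positive definite (positive semidefinite and invertible). For a polynomial $p(z,\bar z)=\sum a_{ij}\bar z^iz^j$ of degree at most $n$, $p(Z,\bar Z):=\sum a_{ij}\bar Z^iZ^j=M(n)\hat p$ denotes the corresponding linear combination of the columns of $M(n)$; so $p(Z,\bar Z)=0$ means $\hat p\in\ker M(n)$. *)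

theory Defs
  imports
    "HOL-Analysis.Analysis"
    "HOL-Library.Poly_Mapping"
    "Jordan_Normal_Form.Matrix"
begin

text \<open>
  A truncated moment sequence is a total function \<open>\<gamma> :: nat \<Rightarrow> nat \<Rightarrow> complex\<close>; for
  degree \<open>2 * n\<close> only the values \<open>\<gamma> i j\<close> with \<open>i + j \<le> 2 * n\<close> are meaningful.
  In every pair \<open>(i, j)\<close> the first component is the exponent of \<open>\<bar>z\<close> and the second one
  the exponent of \<open>z\<close>.
\<close>

type_synonym zpoly = "(nat \<times> nat) \<Rightarrow>\<^sub>0 complex"

definition pz :: zpoly
  where "pz = Poly_Mapping.single (0, 1) 1"

definition pzbar :: zpoly
  where "pzbar = Poly_Mapping.single (1, 0) 1"

definition pconst :: "complex \<Rightarrow> zpoly"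
  where "pconst c = Poly_Mapping.single (0, 0) c"

definition representing_measure ::
    "(nat \<Rightarrow> nat \<Rightarrow> complex) \<Rightarrow> nat \<Rightarrow> complex measure \<Rightarrow> bool"
  where "representing_measure \<gamma> n \<mu> \<longleftrightarrow>
    sets \<mu> = sets borel \<and>
    (\<forall>i j. i + j \<le> 2 * n \<longrightarrow>
       integrable \<mu> (\<lambda>z. cnj z ^ i * z ^ j) \<and>
       \<gamma> i j = integral\<^sup>L \<mu> (\<lambda>z. cnj z ^ i * z ^ j))"

definition riesz :: "(nat \<Rightarrow> nat \<Rightarrow> complex) \<Rightarrow> zpoly \<Rightarrow> complex"
  where "riesz \<gamma> p =
    (\<Sum>(i, j) \<in> Poly_Mapping.keys p. Poly_Mapping.lookup p (i, j) * \<gamma> i j)"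

text \<open>
  Exponent pairs of the monomials of degree at most \<open>n\<close>, in the order
  \<open>1, z, \<bar>z, z\<^sup>2, \<bar>z z, \<bar>z\<^sup>2, \<dots>, z\<^sup>n, \<bar>z z\<^sup>n\<^sup>-\<^sup>1, \<dots>, \<bar>z\<^sup>n\<close>.
\<close>

definition monoms :: "nat \<Rightarrow> (nat \<times> nat) list"
  where "monoms n = concat (map (\<lambda>d. map (\<lambda>i. (i, d - i)) [0..<Suc d]) [0..<Suc n])"

definition moment_matrix :: "(nat \<Rightarrow> nat \<Rightarrow> complex) \<Rightarrow> nat \<Rightarrow> complex mat"
  where "moment_matrix \<gamma> n =
    Matrix.mat (length (monoms n)) (length (monoms n))
      (\<lambda>(r, c). case monoms n ! r of (k, l) \<Rightarrow>
                case monoms n ! c of (i, j) \<Rightarrow> \<gamma> (i + l) (j + k))"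

text \<open>The coefficient vector, meaningful for polynomials of degree at most \<open>n\<close>.\<close>

definition coeff_vec :: "nat \<Rightarrow> zpoly \<Rightarrow> complex Matrix.vec"
  where "coeff_vec n p =
    Matrix.vec (length (monoms n)) (\<lambda>r. Poly_Mapping.lookup p (monoms n ! r))"

text \<open>The element \<open>p(Z, \<bar>Z)\<close> of the column space of \<open>M(n)\<close>.\<close>

definition column_poly :: "(nat \<Rightarrow> nat \<Rightarrow> complex) \<Rightarrow> nat \<Rightarrow> zpoly \<Rightarrow> complex Matrix.vec"
  where "column_poly \<gamma> n p = moment_matrix \<gamma> n *\<^sub>v coeff_vec n p"

text \<open>
  In the order on \<open>complex\<close>, \<open>0 \<le> x\<close> says that \<open>x\<close> is real and nonnegative; hence the
  condition below forces \<open>A\<close> to be Hermitian.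
\<close>

definition psd_mat :: "complex mat \<Rightarrow> bool"
  where "psd_mat A \<longleftrightarrow>
    square_mat A \<and> (\<forall>v \<in> carrier_vec (dim_row A). 0 \<le> (A *\<^sub>v v) \<bullet>c v)"

definition pd_mat :: "complex mat \<Rightarrow> bool"
  where "pd_mat A \<longleftrightarrow> psd_mat A \<and> invertible_mat A"

definition q7 :: "real \<Rightarrow> real \<Rightarrow> zpoly"
  where "q7 u t = pz ^ 3 - pconst (\<i> * of_real t) * pz - pconst (of_real u) * pzbar"

definition qLC :: "real \<Rightarrow> zpoly"
  where "qLC u = pconst \<i> * (pz - pconst \<i> * pzbar) * (pzbar * pz - pconst (of_real u))"

lemma qLC_expand:
  "qLC u = pzbar ^ 2 * pz + pconst \<i> * pzbar * pz ^ 2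
             - pconst (of_real u) * pzbar - pconst (\<i> * of_real u) * pz"
proof -
  have ii: "pconst \<i> * pconst \<i> = - 1"
    by (simp add: pconst_def mult_single flip: single_uminus single_one zero_prod_def)
  have iu: "pconst (\<i> * of_real u) = pconst \<i> * pconst (of_real u)"
    by (simp add: pconst_def mult_single)
  have "qLC u = pconst \<i> * pzbar * pz ^ 2 - (pconst \<i> * pconst \<i>) * (pzbar ^ 2 * pz)
      - pconst \<i> * pconst (of_real u) * pz
      + (pconst \<i> * pconst \<i>) * (pconst (of_real u) * pzbar)"
    by (simp add: qLC_def algebra_simps power2_eq_square)
  then show ?thesis
    unfolding ii iu by (simp add: algebra_simps)
qed

end

theory Submission
  imports Defs
begin

text \<open>
  Let \<open>\<Lambda>\<close> be the Riesz functional. Write \<open>z = \<omega> (x + \<i> y)\<close> with \<open>\<omega> = cis (pi / 4)\<close>. In these rotated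
  real coordinates the two cubics become \<open>q\<^sub>7 = \<omega>\<^sup>3 (F + \<i> G)\<close> and \<open>q\<^sub>L\<^sub>C = - 2 \<omega> R\<close> with the real
  polynomials
  \<open>F = x\<^sup>3 - 3 x y\<^sup>2 - (t - u) x\<close>, \<open>G = 3 x\<^sup>2 y - y\<^sup>3 - (t + u) y\<close> and \<open>R = y (x\<^sup>2 + y\<^sup>2 - u)\<close>
  (called \<open>q7_re\<close>, \<open>q7_im\<close> and \<open>line_circle\<close> below). A column relation \<open>p(Z, \<bar>Z) = 0\<close> of \<open>M(3)\<close> says
  that \<open>\<Lambda>\<close> annihilates every multiple \<open>m p\<close> with \<open>m\<close> of degree at most \<open>3\<close>
  (\<open>column_poly_eq_0_iff\<close>). Because \<open>\<Lambda>\<close> is Hermitian, the relation for \<open>q\<^sub>7\<close> therefore gives those for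
  \<open>F\<close> and \<open>G\<close>.

  (ii) and (iv) are equivalent because, modulo \<open>F\<close> and \<open>G\<close>, every multiple of \<open>R\<close> is a combination of
  \<open>R\<close> and \<open>y R\<close>: one has \<open>2 x R = x G - y F\<close>, and \<open>(y\<^sup>2 + t + u) R\<close> is in the ideal as well. Behind
  this is the fact that \<open>F\<close> and \<open>G\<close> have nine common complex zeros and \<open>R\<close> vanishes at all of them
  except the two where \<open>x = 0\<close> and \<open>y\<^sup>2 = - (t + u)\<close>. (iii) is (ii) written out in moments.

  (i) implies (ii): the column relation gives \<open>\<integral> |q\<^sub>7|\<^sup>2 d\<mu> = 0\<close>, so \<open>\<mu>\<close> lives on the zeros of \<open>q\<^sub>7\<close> in
  the plane, and \<open>q\<^sub>L\<^sub>C\<close> vanishes there.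

  (iv) implies (i): the relations \<open>F\<close>, \<open>G\<close>, \<open>R\<close> together are equivalent to
  \<open>4 y\<^sup>3 = (2 u - t) y\<close>, \<open>4 x\<^sup>2 y = (2 u + t) y\<close> and \<open>x\<^sup>3 = 3 x y\<^sup>2 + (t - u) x\<close>. The first one gives
  \<open>4 \<Lambda>(y\<^sup>4) = (2 u - t) \<Lambda>(y\<^sup>2)\<close>; as \<open>\<Lambda>(y\<^sup>2) > 0\<close> by \<open>M(2) > 0\<close>, this rules out \<open>u < 0\<close>. For
  \<open>u > 0\<close> the common zeros are seven points: the origin, two points on the axis \<open>y = 0\<close>, and the
  four points of a grid symmetric about both axes. Their Lagrange polynomials \<open>f\<^sub>k\<close> have degree at most \<open>3\<close> and
  span \<open>1, x, y, x\<^sup>2, x y, y\<^sup>2, x y\<^sup>2\<close>. The functional \<open>p \<mapsto> \<Lambda>(p) - \<Sum>\<^sub>k \<Lambda>(f\<^sub>k) p(k)\<close> kills each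
  \<open>f\<^sub>k\<close>, hence these seven monomials, hence by the recurrences all polynomials of degree at most \<open>6\<close>. So
  \<open>\<Lambda>\<close> is integration against the atoms \<open>\<Lambda>(f\<^sub>k)\<close>, and these are nonnegative because the cubature
  formula itself yields \<open>\<Lambda>(f\<^sub>k) = \<Lambda>(|f\<^sub>k|\<^sup>2)\<close>.
\<close>

section \<open>Polynomials in \<open>z\<close> and \<open>\<bar>z\<close>, and their Riesz functional\<close>

lemma zpoly_eq_sum_monomials:
  "(p :: zpoly) = (\<Sum>k\<in>Poly_Mapping.keys p. Poly_Mapping.single k (Poly_Mapping.lookup p k))"
  by (rule poly_mapping_eqI) (simp add: lookup_sum lookup_single when_def in_keys_iff)

definition deg_le :: "nat \<Rightarrow> zpoly \<Rightarrow> bool"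
  where "deg_le d p \<longleftrightarrow> (\<forall>(i, j) \<in> Poly_Mapping.keys p. i + j \<le> d)"

lemma deg_le_induct [consumes 1, case_names zero single add]:
  assumes "deg_le d p"
    and "Q 0"
    and "\<And>i j c. i + j \<le> d \<Longrightarrow> Q (Poly_Mapping.single (i, j) c)"
    and "\<And>p q. Q p \<Longrightarrow> Q q \<Longrightarrow> Q (p + q)"
  shows "Q p"
proof -
  have "Q (\<Sum>k\<in>K. Poly_Mapping.single k (Poly_Mapping.lookup p k))"
    if "finite K" "K \<subseteq> Poly_Mapping.keys p" for K
    using that
  proof (induction K rule: finite_induct)
    case (insert k K)
    then show ?case
      using assms(1) by (cases k) (auto simp: deg_le_def intro!: assms(3,4))
  qed (simp add: assms(2))
  from this[of "Poly_Mapping.keys p"] show ?thesis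
    by (simp flip: zpoly_eq_sum_monomials)
qed

lemma deg_le_exists: "\<exists>d. deg_le d p"
proof -
  have "i + j \<le> (\<Sum>(i, j)\<in>Poly_Mapping.keys p. i + j)" if "(i, j) \<in> Poly_Mapping.keys p" for i j
    using member_le_sum[of "(i, j)" "Poly_Mapping.keys p" "\<lambda>(i, j). i + j"] that by auto
  then show ?thesis
    by (auto simp: deg_le_def)
qed

lemma zpoly_induct [case_names zero single add]:
  assumes "Q 0" and "\<And>i j c. Q (Poly_Mapping.single (i, j) c)"
    and "\<And>p q. Q p \<Longrightarrow> Q q \<Longrightarrow> Q (p + q)"
  shows "Q (p :: zpoly)"
  using deg_le_exists[of p] assms by (blast intro: deg_le_induct)

lemma deg_le_single: "i + j \<le> d \<Longrightarrow> deg_le d (Poly_Mapping.single (i, j) c)"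
  by (simp add: deg_le_def)

lemma deg_le_add: "deg_le d p \<Longrightarrow> deg_le d q \<Longrightarrow> deg_le d (p + q)"
  using keys_add[of p q] by (fastforce simp: deg_le_def)

lemma deg_le_mult: "deg_le d p \<Longrightarrow> deg_le e q \<Longrightarrow> deg_le (d + e) (p * q)"
  using keys_mult[of p q] by (fastforce simp: deg_le_def)

lemma deg_le_mono: "deg_le d p \<Longrightarrow> d \<le> e \<Longrightarrow> deg_le e p"
  by (auto simp: deg_le_def)

lemma deg_le_pconst [simp]: "deg_le d (pconst c)"
  by (simp add: pconst_def deg_le_single)

lemma deg_le_one [simp]: "deg_le d 1"
  by (simp add: deg_le_def zero_prod_def)

lemma deg_le_uminus: "deg_le d p \<Longrightarrow> deg_le d (- p)"
  by (auto simp: deg_le_def in_keys_iff)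

lemma deg_le_diff: "deg_le d p \<Longrightarrow> deg_le d q \<Longrightarrow> deg_le d (p - q)"
  using deg_le_add[of d p "- q"] by (simp add: deg_le_uminus)

lemma deg_le_pconst_mult: "deg_le d p \<Longrightarrow> deg_le d (pconst c * p)"
  using deg_le_mult[of 0 "pconst c" d p] by simp

lemma deg_le_power: "deg_le d p \<Longrightarrow> deg_le (n * d) (p ^ n)"
  by (induction n) (auto intro: deg_le_mult)

lemma deg_le_pz: "deg_le 1 pz" and deg_le_pzbar: "deg_le 1 pzbar"
  by (auto simp: pz_def pzbar_def intro: deg_le_single)

lemma pconst_1 [simp]: "pconst 1 = 1"
  and pconst_add: "pconst (a + b) = pconst a + pconst b"
  and pconst_minus: "pconst (a - b) = pconst a - pconst b"
  and pconst_uminus: "pconst (- a) = - pconst a"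
  and pconst_mult: "pconst (a * b) = pconst a * pconst b"
  and pconst_numeral: "pconst (numeral k) = numeral k"
  by (simp_all add: pconst_def single_add single_diff single_uminus mult_single
      flip: zero_prod_def)

lemma single_eq_pconst: "Poly_Mapping.single (i, j) c = pconst c * (pzbar ^ i * pz ^ j)"
proof -
  have 1: "pz ^ j = Poly_Mapping.single (0, j) 1" for j
    by (induction j) (auto simp: pz_def mult_single simp flip: zero_prod_def)
  have 2: "pzbar ^ i = Poly_Mapping.single (i, 0) 1" for i
    by (induction i) (auto simp: pzbar_def mult_single simp flip: zero_prod_def)
  show ?thesis
    unfolding 1 2 by (simp add: pconst_def mult_single)
qed

lemma riesz_superset:
  assumes "finite S" "Poly_Mapping.keys p \<subseteq> S"
  shows "riesz \<gamma> p = (\<Sum>(i, j)\<in>S. Poly_Mapping.lookup p (i, j) * \<gamma> i j)"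
  unfolding riesz_def using assms by (intro sum.mono_neutral_left) (auto simp: in_keys_iff)

lemma riesz_add: "riesz \<gamma> (p + q) = riesz \<gamma> p + riesz \<gamma> q"
proof -
  let ?S = "Poly_Mapping.keys p \<union> Poly_Mapping.keys q"
  have "Poly_Mapping.keys (p + q) \<subseteq> ?S"
    by (rule keys_add)
  then show ?thesis
    by (simp add: riesz_superset[of ?S] lookup_add distrib_right sum.distrib split_def)
qed

lemma riesz_single: "riesz \<gamma> (Poly_Mapping.single (i, j) c) = c * \<gamma> i j"
  by (simp add: riesz_def)

lemma riesz_zero [simp]: "riesz \<gamma> 0 = 0"
  by (simp add: riesz_def)

lemma riesz_one [simp]: "riesz \<gamma> 1 = \<gamma> 0 0"
  by (simp add: riesz_def lookup_one zero_prod_def)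

lemma riesz_pconst_mult: "riesz \<gamma> (pconst c * p) = c * riesz \<gamma> p"
  by (induction p rule: zpoly_induct)
    (simp_all add: riesz_add riesz_single pconst_def mult_single algebra_simps)

lemma riesz_uminus: "riesz \<gamma> (- p) = - riesz \<gamma> p"
  using riesz_pconst_mult[of \<gamma> "-1" p] by (simp add: pconst_uminus)

lemma riesz_diff: "riesz \<gamma> (p - q) = riesz \<gamma> p - riesz \<gamma> q"
  using riesz_add[of \<gamma> p "- q"] by (simp add: riesz_uminus)

lemma riesz_numeral_mult: "riesz \<gamma> (numeral k * p) = numeral k * riesz \<gamma> p"
  using riesz_pconst_mult[of \<gamma> "numeral k" p] by (simp add: pconst_numeral)

lemmas riesz_linear = riesz_add riesz_diff riesz_uminus riesz_pconst_mult riesz_numeral_mult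

text \<open>
  Evaluation at a point is the Riesz functional of the unit mass there, so it inherits linearity, and
  statements about Riesz functionals apply to evaluations too.
\<close>
definition peval :: "zpoly \<Rightarrow> complex \<Rightarrow> complex"
  where "peval p z = riesz (\<lambda>i j. cnj z ^ i * z ^ j) p"

lemma peval_add [simp]: "peval (p + q) z = peval p z + peval q z"
  and peval_diff [simp]: "peval (p - q) z = peval p z - peval q z"
  and peval_0 [simp]: "peval 0 z = 0"
  and peval_1 [simp]: "peval 1 z = 1"
  and peval_single: "peval (Poly_Mapping.single (i, j) c) z = c * (cnj z ^ i * z ^ j)"
  by (simp_all add: peval_def riesz_linear riesz_single)

lemma peval_mult [simp]: "peval (p * q) z = peval p z * peval q z"
proof (induction p rule: zpoly_induct)
  case (single i j c)
  show ?case
    by (induction q rule: zpoly_induct)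
      (simp_all add: peval_single mult_single power_add algebra_simps)
qed (simp_all add: algebra_simps)

lemma peval_power [simp]: "peval (p ^ n) z = peval p z ^ n"
  by (induction n) simp_all

lemma peval_pconst [simp]: "peval (pconst c) z = c"
  and peval_pz [simp]: "peval pz z = z"
  and peval_pzbar [simp]: "peval pzbar z = cnj z"
  by (simp_all add: pconst_def pz_def pzbar_def peval_single)

lemma peval_numeral [simp]: "peval (numeral k) z = numeral k"
  by (metis pconst_numeral peval_pconst)

text \<open>
  The polynomial whose values are the conjugates of those of \<open>p\<close>: conjugating a value exchanges \<open>z\<close>
  and \<open>\<bar>z\<close>, hence the swap of the exponents.
\<close>
definition pconj :: "zpoly \<Rightarrow> zpoly"
  where "pconj p = Poly_Mapping.map cnj (Poly_Mapping.map_key prod.swap p)"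

lemma lookup_pconj: "Poly_Mapping.lookup (pconj p) (i, j) = cnj (Poly_Mapping.lookup p (j, i))"
  by (simp add: pconj_def Poly_Mapping.map.rep_eq map_key.rep_eq when_def)

lemma pconj_single: "pconj (Poly_Mapping.single (i, j) c) = Poly_Mapping.single (j, i) (cnj c)"
  by (rule poly_mapping_eqI) (auto simp: lookup_pconj lookup_single when_def split: if_splits)

lemma pconj_add [simp]: "pconj (p + q) = pconj p + pconj q"
  by (rule poly_mapping_eqI) (auto simp: lookup_pconj lookup_add)

lemma pconj_diff [simp]: "pconj (p - q) = pconj p - pconj q"
  by (rule poly_mapping_eqI) (auto simp: lookup_pconj lookup_minus)

lemma pconj_0 [simp]: "pconj 0 = 0"
  by (rule poly_mapping_eqI) (auto simp: lookup_pconj)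

lemma pconj_mult [simp]: "pconj (p * q) = pconj p * pconj q"
proof (induction p rule: zpoly_induct)
  case (single i j c)
  show ?case
    by (induction q rule: zpoly_induct) (simp_all add: pconj_single mult_single algebra_simps)
qed (simp_all add: algebra_simps)

lemma pconj_pconst [simp]: "pconj (pconst c) = pconst (cnj c)"
  and pconj_pz [simp]: "pconj pz = pzbar"
  and pconj_pzbar [simp]: "pconj pzbar = pz"
  by (simp_all add: pconst_def pz_def pzbar_def pconj_single)

lemma pconj_1 [simp]: "pconj 1 = 1"
  using pconj_pconst[of 1] by simp

lemma pconj_numeral [simp]: "pconj (numeral k) = numeral k"
  using pconj_pconst[of "numeral k"] by (simp add: pconst_numeral)

lemma pconj_power [simp]: "pconj (p ^ n) = pconj p ^ n"
  by (induction n) simp_all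

lemma pconj_pconj [simp]: "pconj (pconj p) = p"
  by (rule poly_mapping_eqI) (auto simp: lookup_pconj)

lemma deg_le_pconj:
  assumes "deg_le d p"
  shows "deg_le d (pconj p)"
  unfolding deg_le_def
proof (intro ballI, clarify)
  fix i j
  assume "(i, j) \<in> Poly_Mapping.keys (pconj p)"
  then have "(j, i) \<in> Poly_Mapping.keys p"
    by (simp add: in_keys_iff lookup_pconj)
  then show "i + j \<le> d"
    using assms by (auto simp: deg_le_def)
qed

lemma peval_pconj [simp]: "peval (pconj p) z = cnj (peval p z)"
  by (induction p rule: zpoly_induct) (simp_all add: pconj_single peval_single)

definition hermitian_upto :: "nat \<Rightarrow> (nat \<Rightarrow> nat \<Rightarrow> complex) \<Rightarrow> bool"
  where "hermitian_upto d \<gamma> \<longleftrightarrow> (\<forall>i j. i + j \<le> d \<longrightarrow> \<gamma> j i = cnj (\<gamma> i j))"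

lemma hermitian_upto_mono: "hermitian_upto d \<gamma> \<Longrightarrow> e \<le> d \<Longrightarrow> hermitian_upto e \<gamma>"
  unfolding hermitian_upto_def by (meson order_trans)

lemma riesz_pconj:
  assumes "hermitian_upto d \<gamma>" "deg_le d p"
  shows "riesz \<gamma> (pconj p) = cnj (riesz \<gamma> p)"
  using assms(2)
proof (induction rule: deg_le_induct)
  case (single i j c)
  then have "\<gamma> j i = cnj (\<gamma> i j)"
    using assms(1) unfolding hermitian_upto_def by blast
  then show ?case
    by (simp add: pconj_single riesz_single)
qed (simp_all add: riesz_add)

section \<open>Moment matrices read through the Riesz functional\<close>

lemma set_monoms: "set (monoms n) = {(i, j). i + j \<le> n}"
proof -
  have "(i, j) \<in> set (monoms n) \<longleftrightarrow> i + j \<le> n" for i j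
  proof
    assume "i + j \<le> n"
    then have "i + j \<in> {0..<Suc n}" "(i, j) \<in> (\<lambda>k. (k, i + j - k)) ` {0..<Suc (i + j)}"
      by (auto intro!: image_eqI[of _ _ i])
    then show "(i, j) \<in> set (monoms n)"
      unfolding monoms_def by (auto simp del: upt_Suc)
  qed (auto simp: monoms_def simp del: upt_Suc)
  then show ?thesis
    by auto
qed

lemma monoms_Suc: "monoms (Suc n) = monoms n @ map (\<lambda>i. (i, Suc n - i)) [0..<Suc (Suc n)]"
  by (simp add: monoms_def)

lemma distinct_monoms: "distinct (monoms n)"
proof (induction n)
  case (Suc n)
  have "distinct (map (\<lambda>i. (i, Suc n - i)) [0..<Suc (Suc n)])"
    by (simp add: distinct_map inj_on_def del: upt_Suc)
  then show ?case
    using Suc by (auto simp: monoms_Suc set_monoms simp del: upt_Suc)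
qed (simp add: monoms_def)

lemma sum_over_monoms:
  "(\<Sum>r<length (monoms n). f (monoms n ! r)) = (\<Sum>k\<in>{(i, j). i + j \<le> n}. f k)"
  using sum.reindex_bij_betw[OF bij_betw_nth[OF distinct_monoms refl refl], of f n]
  by (simp add: set_monoms)

lemma finite_monoms: "finite {(i, j). i + j \<le> (n :: nat)}"
  using finite_set[of "monoms n"] by (simp add: set_monoms)

lemma keys_subset_monoms: "deg_le n p \<Longrightarrow> Poly_Mapping.keys p \<subseteq> {(i, j). i + j \<le> n}"
  by (auto simp: deg_le_def)

lemma riesz_single_mult:
  "riesz \<gamma> (Poly_Mapping.single (l, k) c * p) = c * riesz (\<lambda>i j. \<gamma> (i + l) (j + k)) p"
  by (induction p rule: zpoly_induct)
    (simp_all add: riesz_add riesz_single mult_single algebra_simps)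

lemma column_poly_index:
  assumes "r < length (monoms n)" "monoms n ! r = (k, l)" "deg_le n p"
  shows "vec_index (column_poly \<gamma> n p) r = riesz \<gamma> (Poly_Mapping.single (l, k) 1 * p)"
proof -
  have "vec_index (column_poly \<gamma> n p) r
      = (\<Sum>c<length (monoms n). (case monoms n ! c of (i, j) \<Rightarrow>
          Poly_Mapping.lookup p (i, j) * \<gamma> (i + l) (j + k)))"
    using assms(1,2)
    by (auto simp: column_poly_def moment_matrix_def coeff_vec_def scalar_prod_def
        lessThan_atLeast0 split_def mult.commute intro!: sum.cong)
  also have "\<dots> = riesz (\<lambda>i j. \<gamma> (i + l) (j + k)) p"
    unfolding sum_over_monoms
    by (rule riesz_superset[symmetric, OF finite_monoms keys_subset_monoms[OF assms(3)]])
  finally show ?thesis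
    by (simp add: riesz_single_mult)
qed

text \<open>
  The coordinate-free form of a column relation. It is stable under conjugation and linear
  combinations, which is how the relations for the real and imaginary parts of a polynomial are obtained.
\<close>
definition annihilates :: "(nat \<Rightarrow> nat \<Rightarrow> complex) \<Rightarrow> nat \<Rightarrow> zpoly \<Rightarrow> bool"
  where "annihilates \<gamma> n p \<longleftrightarrow> (\<forall>m. deg_le n m \<longrightarrow> riesz \<gamma> (m * p) = 0)"

lemma annihilatesD: "annihilates \<gamma> n p \<Longrightarrow> deg_le n m \<Longrightarrow> riesz \<gamma> (m * p) = 0"
  by (simp add: annihilates_def)

lemma annihilates_add: "annihilates \<gamma> n p \<Longrightarrow> annihilates \<gamma> n q \<Longrightarrow> annihilates \<gamma> n (p + q)"
  and annihilates_diff: "annihilates \<gamma> n p \<Longrightarrow> annihilates \<gamma> n q \<Longrightarrow> annihilates \<gamma> n (p - q)"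
  by (auto simp: annihilates_def algebra_simps riesz_linear)

lemma annihilates_pconst_mult: "annihilates \<gamma> n p \<Longrightarrow> annihilates \<gamma> n (pconst c * p)"
  by (simp add: annihilates_def mult.left_commute[of _ "pconst c"] riesz_linear)

lemma annihilates_pconj:
  assumes "hermitian_upto d \<gamma>" "annihilates \<gamma> n p" "deg_le e p" "n + e \<le> d"
  shows "annihilates \<gamma> n (pconj p)"
  unfolding annihilates_def
proof (intro allI impI)
  fix m
  assume m: "deg_le n m"
  have "deg_le d (pconj m * p)"
    using deg_le_mult[OF deg_le_pconj[OF m] assms(3)] assms(4) by (rule deg_le_mono)
  from riesz_pconj[OF assms(1) this] show "riesz \<gamma> (m * pconj p) = 0"
    using annihilatesD[OF assms(2) deg_le_pconj[OF m]] by simp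
qed

text \<open>
  The entry of \<open>p(Z, \<bar>Z)\<close> in the row of \<open>\<bar>z\<^sup>k z\<^sup>l\<close> is the Riesz functional of \<open>\<bar>z\<^sup>l z\<^sup>k p\<close>, and these
  multipliers span all polynomials of degree at most \<open>n\<close>.
\<close>
lemma column_poly_eq_0_iff:
  assumes "deg_le n p"
  shows "column_poly \<gamma> n p = 0\<^sub>v (length (monoms n)) \<longleftrightarrow> annihilates \<gamma> n p"
proof
  assume "annihilates \<gamma> n p"
  show "column_poly \<gamma> n p = 0\<^sub>v (length (monoms n))"
  proof (rule eq_vecI)
    fix r
    assume "r < dim_vec (0\<^sub>v (length (monoms n)))"
    then have r: "r < length (monoms n)"
      by simp
    obtain k l where kl: "monoms n ! r = (k, l)"
      by force
    then have "k + l \<le> n"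
      using nth_mem[OF r] by (auto simp: set_monoms)
    then have "deg_le n (Poly_Mapping.single (l, k) 1)"
      by (simp add: deg_le_single)
    then show "vec_index (column_poly \<gamma> n p) r = vec_index (0\<^sub>v (length (monoms n))) r"
      using column_poly_index[OF r kl assms] r \<open>annihilates \<gamma> n p\<close> by (simp add: annihilates_def)
  qed (simp add: column_poly_def moment_matrix_def)
next
  assume col: "column_poly \<gamma> n p = 0\<^sub>v (length (monoms n))"
  show "annihilates \<gamma> n p"
    unfolding annihilates_def
  proof (intro allI impI)
    fix m
    assume "deg_le n m"
    then show "riesz \<gamma> (m * p) = 0"
    proof (induction rule: deg_le_induct)
      case (single l k c)
      then have "(k, l) \<in> set (monoms n)"
        by (simp add: set_monoms)
      then obtain r where r: "r < length (monoms n)" "monoms n ! r = (k, l)"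
        by (auto simp: in_set_conv_nth)
      have "riesz \<gamma> (Poly_Mapping.single (l, k) 1 * p) = 0"
        using column_poly_index[OF r assms, of \<gamma>] col r(1) by simp
      then show ?case
        by (simp add: riesz_single_mult)
    qed (simp_all add: distrib_right riesz_add)
  qed
qed

lemma hermitian_form_eq_riesz:
  assumes "deg_le n p"
  shows "(moment_matrix \<gamma> n *\<^sub>v coeff_vec n p) \<bullet>c coeff_vec n p = riesz \<gamma> (pconj p * p)"
proof -
  let ?S = "{(i, j). i + j \<le> n}"
  have sum_eq: "(\<Sum>(k, l)\<in>?S. riesz \<gamma> (Poly_Mapping.single (l, k) 1 * p) * cnj (Poly_Mapping.lookup q (k, l)))
      = riesz \<gamma> (pconj q * p)" if "deg_le n q" for q
    using that
  proof (induction rule: deg_le_induct)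
    case (single i j c)
    have "(\<Sum>(k, l)\<in>?S. riesz \<gamma> (Poly_Mapping.single (l, k) 1 * p)
          * cnj (Poly_Mapping.lookup (Poly_Mapping.single (i, j) c) (k, l)))
      = (\<Sum>(k, l)\<in>{(i, j)}. riesz \<gamma> (Poly_Mapping.single (l, k) 1 * p)
          * cnj (Poly_Mapping.lookup (Poly_Mapping.single (i, j) c) (k, l)))"
      using single finite_monoms[of n]
      by (intro sum.mono_neutral_right) (auto simp: lookup_single when_def split: if_splits)
    then show ?case
      by (simp add: pconj_single riesz_single_mult)
  qed (simp_all add: lookup_add algebra_simps riesz_add sum.distrib split_def)
  have "(moment_matrix \<gamma> n *\<^sub>v coeff_vec n p) \<bullet>c coeff_vec n p
    = (\<Sum>r<length (monoms n). vec_index (column_poly \<gamma> n p) r * cnj (Poly_Mapping.lookup p (monoms n ! r)))"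
    by (simp add: scalar_prod_def column_poly_def coeff_vec_def lessThan_atLeast0)
  also have "\<dots> = (\<Sum>r<length (monoms n). (case monoms n ! r of (k, l) \<Rightarrow>
      riesz \<gamma> (Poly_Mapping.single (l, k) 1 * p) * cnj (Poly_Mapping.lookup p (k, l))))"
    by (intro sum.cong refl) (simp add: column_poly_index[OF _ _ assms] split: prod.split)
  also have "\<dots> = riesz \<gamma> (pconj p * p)"
    unfolding sum_over_monoms by (rule sum_eq[OF assms])
  finally show ?thesis .
qed

lemma riesz_square_nonneg:
  assumes "psd_mat (moment_matrix \<gamma> n)" "deg_le n p"
  shows "0 \<le> riesz \<gamma> (pconj p * p)"
proof -
  have "coeff_vec n p \<in> carrier_vec (dim_row (moment_matrix \<gamma> n))"
    by (simp add: coeff_vec_def moment_matrix_def)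
  then show ?thesis
    using assms(1) unfolding psd_mat_def hermitian_form_eq_riesz[OF assms(2), symmetric] by blast
qed

text \<open>
  Cauchy--Schwarz for a semidefinite form: if \<open>\<Lambda>(m p) = c \<noteq> 0\<close>, then perturbing \<open>\<bar>m\<close> in the isotropic
  direction \<open>p\<close> changes its square only by a linear term, which can be made arbitrarily negative.
\<close>
lemma annihilates_if_riesz_square_eq_0:
  assumes psd: "psd_mat (moment_matrix \<gamma> n)" and herm: "hermitian_upto (2 * n) \<gamma>"
    and p: "deg_le n p" and zero: "riesz \<gamma> (pconj p * p) = 0"
  shows "annihilates \<gamma> n p"
  unfolding annihilates_def
proof (intro allI impI)
  fix m
  assume m: "deg_le n m"
  define c where "c = riesz \<gamma> (m * p)"
  define r where "r = Re (riesz \<gamma> (m * pconj m))"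
  have "deg_le (2 * n) (m * p)"
    using deg_le_mult[OF m p] by (simp add: mult_2)
  from riesz_pconj[OF herm this] have c': "riesz \<gamma> (pconj m * pconj p) = cnj c"
    by (simp add: c_def)
  have main: "0 \<le> r - 2 * s * (cmod c)\<^sup>2" for s :: real
  proof -
    define a where "a = - complex_of_real s * cnj c"
    let ?f = "pconj m + pconst a * p"
    have "deg_le n ?f"
      using m p by (intro deg_le_add deg_le_pconj deg_le_pconst_mult)
    then have "0 \<le> riesz \<gamma> (pconj ?f * ?f)"
      by (rule riesz_square_nonneg[OF psd])
    moreover have "pconj ?f * ?f = m * pconj m + pconst a * (m * p)
        + pconst (cnj a) * (pconj m * pconj p) + pconst a * (pconst (cnj a) * (pconj p * p))"
      by (simp add: algebra_simps)
    ultimately have "0 \<le> riesz \<gamma> (m * pconj m) + a * c + cnj a * cnj c"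
      by (simp add: riesz_linear zero c' flip: c_def)
    then have "0 \<le> Re (riesz \<gamma> (m * pconj m) + a * c + cnj a * cnj c)"
      by (simp add: less_eq_complex_def)
    moreover have "a * c = - of_real (s * (cmod c)\<^sup>2)" "cnj a * cnj c = - of_real (s * (cmod c)\<^sup>2)"
      using complex_norm_square[of c] by (simp_all add: a_def mult.commute)
    ultimately show ?thesis
      by (simp add: r_def)
  qed
  show "riesz \<gamma> (m * p) = 0"
  proof (rule ccontr)
    assume "riesz \<gamma> (m * p) \<noteq> 0"
    then have pos: "(cmod c)\<^sup>2 > 0"
      by (simp add: c_def)
    then show False
      \<comment> \<open>With this \<open>s\<close> the right-hand side of \<open>main\<close> is \<open>- 1\<close>.\<close>
      using main[of "(r + 1) / (2 * (cmod c)\<^sup>2)"] by simp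
  qed
qed

lemma mult_mat_vec_eq_0_imp:
  fixes A :: "complex mat"
  assumes "invertible_mat A" "v \<in> carrier_vec (dim_col A)" "A *\<^sub>v v = 0\<^sub>v (dim_row A)"
  shows "v = 0\<^sub>v (dim_col A)"
proof -
  obtain B where AB: "A * B = 1\<^sub>m (dim_row A)" and BA: "B * A = 1\<^sub>m (dim_row B)"
    using assms(1) by (auto simp: invertible_mat_def inverts_mat_def)
  have dims: "dim_col B = dim_row A" "dim_row B = dim_col A"
    using arg_cong[OF AB, of dim_col] arg_cong[OF BA, of dim_col] by simp_all
  have "v = (B * A) *\<^sub>v v"
    using assms(2) by (simp add: BA dims)
  also have "\<dots> = B *\<^sub>v (A *\<^sub>v v)"
    using assms(2) dims by (intro assoc_mult_mat_vec[of _ "dim_col A" "dim_row A" _ "dim_col A"]) auto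
  also have "\<dots> = 0\<^sub>v (dim_col A)"
    unfolding assms(3) using dims by (intro eq_vecI) (auto simp: scalar_prod_def)
  finally show ?thesis .
qed

lemma not_annihilates_if_pd:
  assumes "pd_mat (moment_matrix \<gamma> n)" "deg_le n p" "p \<noteq> 0"
  shows "\<not> annihilates \<gamma> n p"
proof
  assume "annihilates \<gamma> n p"
  then have "moment_matrix \<gamma> n *\<^sub>v coeff_vec n p = 0\<^sub>v (length (monoms n))"
    using column_poly_eq_0_iff[OF assms(2)] by (simp add: column_poly_def)
  moreover have "invertible_mat (moment_matrix \<gamma> n)"
    using assms(1) by (simp add: pd_mat_def)
  ultimately have v: "coeff_vec n p = 0\<^sub>v (length (monoms n))"
    using mult_mat_vec_eq_0_imp[of "moment_matrix \<gamma> n" "coeff_vec n p"]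
    by (simp add: moment_matrix_def coeff_vec_def)
  have "Poly_Mapping.lookup p k = 0" for k
  proof (cases "k \<in> set (monoms n)")
    case True
    then obtain r where r: "r < length (monoms n)" "monoms n ! r = k"
      by (auto simp: in_set_conv_nth)
    then show ?thesis
      using arg_cong[OF v, of "\<lambda>v. vec_index v r"] by (simp add: coeff_vec_def)
  next
    case False
    then show ?thesis
      using keys_subset_monoms[OF assms(2)] by (auto simp: set_monoms in_keys_iff)
  qed
  then show False
    using assms(3) by (auto intro: poly_mapping_eqI)
qed

section \<open>Representing measures\<close>

lemma representing_measure_integral:
  assumes "representing_measure \<gamma> n \<mu>" "deg_le (2 * n) p"
  shows "integrable \<mu> (peval p) \<and> riesz \<gamma> p = integral\<^sup>L \<mu> (peval p)"
  using assms(2)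
proof (induction rule: deg_le_induct)
  case (single i j c)
  then have "integrable \<mu> (\<lambda>z. cnj z ^ i * z ^ j)" "\<gamma> i j = integral\<^sup>L \<mu> (\<lambda>z. cnj z ^ i * z ^ j)"
    using assms(1) by (auto simp: representing_measure_def)
  then show ?case
    by (simp add: peval_single riesz_single)
next
  case (add p q)
  then show ?case
    by (simp add: riesz_add)
qed (simp add: riesz_def)

text \<open>The relation gives \<open>\<integral> |p|\<^sup>2 d\<mu> = \<Lambda>(\<bar>p p) = 0\<close>.\<close>
lemma annihilates_AE_eq_0:
  assumes rep: "representing_measure \<gamma> n \<mu>" and p: "deg_le n p" and ann: "annihilates \<gamma> n p"
  shows "AE z in \<mu>. peval p z = 0"
proof -
  have "deg_le (2 * n) (pconj p * p)"
    using deg_le_mult[OF deg_le_pconj[OF p] p] by (simp add: mult_2)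
  from representing_measure_integral[OF rep this]
  have int: "integrable \<mu> (peval (pconj p * p))" "integral\<^sup>L \<mu> (peval (pconj p * p)) = 0"
    using annihilatesD[OF ann deg_le_pconj[OF p]] by simp_all
  have eq: "peval (pconj p * p) = (\<lambda>z. complex_of_real ((cmod (peval p z))\<^sup>2))"
    by (simp only: fun_eq_iff peval_mult peval_pconj complex_norm_square) (simp add: mult.commute)
  have "integrable \<mu> (\<lambda>z. (cmod (peval p z))\<^sup>2)" "integral\<^sup>L \<mu> (\<lambda>z. (cmod (peval p z))\<^sup>2) = 0"
    using int unfolding eq by (simp_all only: complex_of_real_integrable_eq integral_complex_of_real of_real_eq_0_iff)
  then have "AE z in \<mu>. (cmod (peval p z))\<^sup>2 = 0"
    by (subst (asm) integral_nonneg_eq_0_iff_AE) auto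
  then show ?thesis
    by simp
qed

lemma representing_measure_atomic:
  fixes w :: "'k \<Rightarrow> real" and x :: "'k \<Rightarrow> complex"
  assumes K: "finite K" and w: "\<And>k. k \<in> K \<Longrightarrow> 0 \<le> w k"
    and \<gamma>: "\<And>i j. i + j \<le> 2 * n \<Longrightarrow> \<gamma> i j = (\<Sum>k\<in>K. of_real (w k) * (cnj (x k) ^ i * x k ^ j))"
  shows "\<exists>\<mu>. representing_measure \<gamma> n \<mu>"
proof
  let ?\<nu> = "point_measure K (\<lambda>k. ennreal (w k))"
  have x: "x \<in> measurable ?\<nu> borel"
    by (simp add: point_measure_def)
  have borel: "(\<lambda>z. cnj z ^ i * z ^ j) \<in> borel_measurable borel" for i j
    by (intro borel_measurable_continuous_onI continuous_intros)
  show "representing_measure \<gamma> n (distr ?\<nu> borel x)"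
    unfolding representing_measure_def
  proof (intro conjI allI impI)
    fix i j
    assume ij: "i + j \<le> 2 * n"
    show "integrable (distr ?\<nu> borel x) (\<lambda>z. cnj z ^ i * z ^ j)"
      by (subst integrable_distr_eq[OF x borel]) (rule integrable_point_measure_finite[OF K])
    show "\<gamma> i j = integral\<^sup>L (distr ?\<nu> borel x) (\<lambda>z. cnj z ^ i * z ^ j)"
      by (subst integral_distr[OF x borel])
        (simp add: lebesgue_integral_point_measure_finite[OF K w] \<gamma>[OF ij] scaleR_conv_of_real)
  qed simp
qed

text \<open>
  A functional minus a cubature sum is again the Riesz functional of a sequence, so that everything
  proved for Riesz functionals can be applied to the error of a cubature formula.
\<close>
lemma riesz_minus_atoms:
  "riesz (\<lambda>i j. \<gamma> i j - (\<Sum>k\<in>K. w k * (cnj (x k) ^ i * x k ^ j))) p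
    = riesz \<gamma> p - (\<Sum>k\<in>K. w k * peval p (x k))"
proof (induction p rule: zpoly_induct)
  case (single i j c)
  show ?case
    by (simp add: riesz_single peval_single algebra_simps sum_distrib_left)
next
  case (add p q)
  then show ?case
    by (simp only: riesz_add peval_add distrib_left sum.distrib) simp
qed simp

text \<open>
  A cubature formula with Lagrange weights has nonnegative weights for free: \<open>|f\<^sub>k|\<^sup>2\<close> takes the same
  values as \<open>f\<^sub>k\<close> at all nodes, so applying the formula to it, which its degree \<open>2 n\<close> permits, gives
  \<open>\<Lambda>(f\<^sub>k) = \<Lambda>(|f\<^sub>k|\<^sup>2)\<close>.
\<close>
lemma representing_measure_if_lagrange:
  fixes x :: "'k \<Rightarrow> complex"
  assumes K: "finite K" and psd: "psd_mat (moment_matrix \<gamma> n)"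
    and f: "\<And>k. k \<in> K \<Longrightarrow> deg_le n (f k)"
    and interp: "\<And>k l. k \<in> K \<Longrightarrow> l \<in> K \<Longrightarrow> peval (f k) (x l) = (if k = l then 1 else 0)"
    and cub: "\<And>p. deg_le (2 * n) p \<Longrightarrow> riesz \<gamma> p = (\<Sum>k\<in>K. riesz \<gamma> (f k) * peval p (x k))"
  shows "\<exists>\<mu>. representing_measure \<gamma> n \<mu>"
proof (rule representing_measure_atomic[OF K])
  have w: "0 \<le> riesz \<gamma> (f k)" if "k \<in> K" for k
  proof -
    have "deg_le (2 * n) (pconj (f k) * f k)"
      using deg_le_mult[OF deg_le_pconj[OF f[OF that]] f[OF that]] by (simp add: mult_2)
    from cub[OF this] have "riesz \<gamma> (pconj (f k) * f k)
        = (\<Sum>l\<in>K. if l = k then riesz \<gamma> (f k) else 0)"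
      using that by (auto simp: interp intro!: sum.cong)
    then have "riesz \<gamma> (pconj (f k) * f k) = riesz \<gamma> (f k)"
      using K that by simp
    then show ?thesis
      using riesz_square_nonneg[OF psd f[OF that]] by simp
  qed
  show "0 \<le> Re (riesz \<gamma> (f k))" if "k \<in> K" for k
    using w[OF that] by (simp add: less_eq_complex_def)
  fix i j :: nat
  assume "i + j \<le> 2 * n"
  then have "riesz \<gamma> (Poly_Mapping.single (i, j) 1)
      = (\<Sum>k\<in>K. riesz \<gamma> (f k) * peval (Poly_Mapping.single (i, j) 1) (x k))"
    by (intro cub deg_le_single)
  also have "\<dots> = (\<Sum>k\<in>K. of_real (Re (riesz \<gamma> (f k))) * (cnj (x k) ^ i * x k ^ j))"
    using w by (intro sum.cong) (auto simp: peval_single less_eq_complex_def complex_eq_iff)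
  finally show "\<gamma> i j = (\<Sum>k\<in>K. of_real (Re (riesz \<gamma> (f k))) * (cnj (x k) ^ i * x k ^ j))"
    by (simp add: riesz_single)
qed

section \<open>Rotated real coordinates\<close>

text \<open>
  The line \<open>z = \<i> \<bar>z\<close>, on which \<open>qLC\<close> vanishes, is the real axis turned by \<open>pi / 4\<close>. Turning it back
  makes all coefficients real.
\<close>
definition rot :: complex
  where "rot = cis (pi / 4)"

lemma rot_cnj: "rot * cnj rot = 1"
  and rot_square: "rot * rot = \<i>"
  by (simp_all add: rot_def cis_mult cis_cnj)

definition px :: zpoly
  where "px = pconst (1 / 2) * (pconst (cnj rot) * pz + pconst rot * pzbar)"

definition py :: zpoly
  where "py = pconst (1 / 2) * (pconst \<i> * (pconst rot * pzbar - pconst (cnj rot) * pz))"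

lemma deg_le_px: "deg_le 1 px" and deg_le_py: "deg_le 1 py"
  unfolding px_def py_def
  by (intro deg_le_add deg_le_diff deg_le_pconst_mult deg_le_pz deg_le_pzbar)+

lemma cnj_rot: "cnj rot = - (rot * rot * rot)"
  by (simp add: rot_square) (simp add: rot_def cis_cnj complex_eq_iff cos_45 sin_45)

lemma pz_eq: "pz = pconst rot * (px + pconst \<i> * py)"
  and pzbar_eq: "pzbar = pconst (cnj rot) * (px - pconst \<i> * py)"
proof -
  let ?V = "pconst (cnj rot) * pz" and ?W = "pconst rot * pzbar"
  have half: "pconst (1 / 2) * p + pconst (1 / 2) * p = p" for p
    by (simp flip: distrib_right pconst_add)
  have "pconst \<i> * py = pconst (1 / 2) * (pconst (\<i> * \<i>) * (?W - ?V))"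
    by (simp only: py_def pconst_mult ac_simps)
  then have iy: "pconst \<i> * py = pconst (1 / 2) * (?V - ?W)"
    by (simp add: pconst_uminus)
  have "px + pconst \<i> * py = pconst (1 / 2) * ?V + pconst (1 / 2) * ?V"
    unfolding iy by (simp add: px_def distrib_left right_diff_distrib)
  then have "px + pconst \<i> * py = ?V"
    by (simp only: half)
  then show "pz = pconst rot * (px + pconst \<i> * py)"
    by (simp add: rot_cnj flip: pconst_mult mult.assoc)
  have "px - pconst \<i> * py = pconst (1 / 2) * ?W + pconst (1 / 2) * ?W"
    unfolding iy by (simp add: px_def distrib_left right_diff_distrib)
  then have "px - pconst \<i> * py = ?W"
    by (simp only: half)
  then show "pzbar = pconst (cnj rot) * (px - pconst \<i> * py)"
    by (simp add: rot_cnj mult.commute[of "cnj rot"] flip: pconst_mult mult.assoc)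
qed

lemma pconj_px [simp]: "pconj px = px" and pconj_py [simp]: "pconj py = py"
  by (simp_all add: px_def py_def add.commute pconst_uminus algebra_simps)

definition point :: "real \<Rightarrow> real \<Rightarrow> complex"
  where "point a b = rot * Complex a b"

lemma peval_px_point [simp]: "peval px (point a b) = of_real a"
  and peval_py_point [simp]: "peval py (point a b) = of_real b"
proof -
  have z: "cnj rot * point a b = Complex a b" "rot * cnj (point a b) = cnj (Complex a b)"
    by (simp_all add: point_def rot_cnj mult.commute flip: mult.assoc)
  have "peval px (point a b) = (cnj rot * point a b + rot * cnj (point a b)) / 2"
    by (simp add: px_def add_divide_distrib)
  then show "peval px (point a b) = of_real a"
    unfolding z by (simp add: complex_eq_iff)
  have "peval py (point a b) = - \<i> * (cnj rot * point a b - rot * cnj (point a b)) / 2"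
    by (simp add: py_def algebra_simps diff_divide_distrib)
  then show "peval py (point a b) = of_real b"
    unfolding z by (simp add: complex_eq_iff)
qed

lemma point_cases: obtains a b where "z = point a b"
proof
  show "z = point (Re (cnj rot * z)) (Im (cnj rot * z))"
    by (simp only: point_def complex_surj) (simp add: rot_cnj flip: mult.assoc)
qed

lemma deg_le_numeral [simp]: "deg_le d (numeral k)"
  using deg_le_pconst[of d "numeral k"] by (simp only: pconst_numeral)

lemma deg_le_px_py: "i + j \<le> d \<Longrightarrow> deg_le d (px ^ i * py ^ j)"
  using deg_le_mult[OF deg_le_power[OF deg_le_px, of i] deg_le_power[OF deg_le_py, of j]]
  by (auto intro: deg_le_mono)

text \<open>
  The monomials in \<open>x, y\<close> span the same polynomials, degree by degree, as those in \<open>z, \<bar>z\<close>: factors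
  \<open>z\<close> and \<open>\<bar>z\<close> are traded for linear forms in \<open>x, y\<close> one at a time.
\<close>
lemma annihilates_if_px_py:
  assumes mon: "\<And>i j. i + j \<le> n \<Longrightarrow> riesz \<gamma> (px ^ i * py ^ j * r) = 0"
  shows "annihilates \<gamma> n r"
proof -
  have claim: "riesz \<gamma> (pzbar ^ k * pz ^ l * (px ^ i * py ^ j * r)) = 0" if "k + l + i + j \<le> n" for k l i j
    using that
  proof (induction "k + l" arbitrary: k l i j)
    case 0
    then show ?case by (simp add: mon)
  next
    case (Suc d)
    show ?case
    proof (cases k)
      case 0
      then obtain l' where l: "l = Suc l'"
        using Suc.hyps(2) by (cases l) auto
      have "pzbar ^ k * pz ^ l * (px ^ i * py ^ j * r)
        = pconst rot * (pzbar ^ k * pz ^ l' * (px ^ Suc i * py ^ j * r))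
        + pconst rot * (pconst \<i> * (pzbar ^ k * pz ^ l' * (px ^ i * py ^ Suc j * r)))"
        unfolding l power_Suc pz_eq[THEN arg_cong, of "\<lambda>w. w * pz ^ l'"] by (simp add: algebra_simps)
      moreover have "riesz \<gamma> (pzbar ^ k * pz ^ l' * (px ^ Suc i * py ^ j * r)) = 0"
        "riesz \<gamma> (pzbar ^ k * pz ^ l' * (px ^ i * py ^ Suc j * r)) = 0"
        using Suc.prems Suc.hyps(2) l by (intro Suc.hyps(1); simp)+
      ultimately show ?thesis
        by (simp only: riesz_linear) simp
    next
      case (Suc k')
      have "pzbar ^ k * pz ^ l * (px ^ i * py ^ j * r)
        = pconst (cnj rot) * (pzbar ^ k' * pz ^ l * (px ^ Suc i * py ^ j * r))
        - pconst (cnj rot) * (pconst \<i> * (pzbar ^ k' * pz ^ l * (px ^ i * py ^ Suc j * r)))"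
        unfolding Suc power_Suc pzbar_eq[THEN arg_cong, of "\<lambda>w. w * pzbar ^ k'"] by (simp add: algebra_simps)
      moreover have "riesz \<gamma> (pzbar ^ k' * pz ^ l * (px ^ Suc i * py ^ j * r)) = 0"
        "riesz \<gamma> (pzbar ^ k' * pz ^ l * (px ^ i * py ^ Suc j * r)) = 0"
        using Suc.prems Suc.hyps(2) Suc by (intro Suc.hyps(1); simp)+
      ultimately show ?thesis
        by (simp only: riesz_linear) simp
    qed
  qed
  show ?thesis
    unfolding annihilates_def
  proof (intro allI impI)
    fix m
    assume "deg_le n m"
    then show "riesz \<gamma> (m * r) = 0"
    proof (induction rule: deg_le_induct)
      case (single i j c)
      then show ?case
        using claim[of i j 0 0] by (simp add: single_eq_pconst mult.assoc riesz_linear)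
    qed (simp_all add: distrib_right riesz_linear)
  qed
qed

lemma deg_le_riesz_eq_0:
  assumes "\<And>i j. i + j \<le> n \<Longrightarrow> riesz \<gamma> (px ^ i * py ^ j) = 0" "deg_le n p"
  shows "riesz \<gamma> p = 0"
  using annihilatesD[OF annihilates_if_px_py[of n \<gamma> 1] assms(2)] assms(1) by simp

section \<open>The cubics in rotated coordinates\<close>

text \<open>
  The polynomials \<open>F\<close>, \<open>G\<close> and \<open>R\<close> of the introduction: real and imaginary part of \<open>q7\<close>, and \<open>qLC\<close> as
  the product of the line \<open>y = 0\<close> and the conic \<open>x\<^sup>2 + y\<^sup>2 = u\<close>, up to constant factors.
\<close>
definition q7_re :: "real \<Rightarrow> real \<Rightarrow> zpoly"
  where "q7_re u t = px ^ 3 - 3 * px * py\<^sup>2 - pconst (of_real (t - u)) * px"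

definition q7_im :: "real \<Rightarrow> real \<Rightarrow> zpoly"
  where "q7_im u t = 3 * px\<^sup>2 * py - py ^ 3 - pconst (of_real (t + u)) * py"

definition line_circle :: "real \<Rightarrow> zpoly"
  where "line_circle u = py * (px\<^sup>2 + py\<^sup>2 - pconst (of_real u))"

lemma q7_eq: "q7 u t = pconst (rot ^ 3) * (q7_re u t + pconst \<i> * q7_im u t)"
proof -
  define I where "I = pconst \<i>"
  define W where "W = pconst rot"
  have II: "I * I = - 1" "I * (I * p) = - p" for p
    by (simp_all add: I_def pconst_uminus flip: pconst_mult mult.assoc)
  have WW: "pconst (\<i> * of_real t) * pz = pconst (rot ^ 3) * (pconst (of_real t) * (px + I * py))"
    unfolding pz_eq I_def
    by (simp add: power3_eq_cube rot_square pconst_mult ac_simps)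
  have UU: "pconst (of_real u) * pzbar = - pconst (rot ^ 3) * (pconst (of_real u) * (px - I * py))"
    unfolding pzbar_eq I_def cnj_rot
    by (simp add: power3_eq_cube pconst_mult pconst_uminus ac_simps)
  have ZZ: "pz ^ 3 = pconst (rot ^ 3) * (px + I * py) ^ 3"
    unfolding pz_eq I_def by (simp add: power3_eq_cube pconst_mult ac_simps)
  have "q7 u t = pconst (rot ^ 3) * ((px + I * py) ^ 3 - pconst (of_real t) * (px + I * py)
      + pconst (of_real u) * (px - I * py))"
    unfolding q7_def WW UU ZZ by (simp add: algebra_simps)
  also have "(px + I * py) ^ 3 - pconst (of_real t) * (px + I * py) + pconst (of_real u) * (px - I * py)
      = q7_re u t + I * q7_im u t"
    by (simp add: q7_re_def q7_im_def power3_eq_cube power2_eq_square algebra_simps II pconst_add pconst_minus)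
  finally show ?thesis
    by (simp add: I_def)
qed

lemma qLC_eq: "qLC u = pconst (- 2 * rot) * line_circle u"
proof -
  define I where "I = pconst \<i>"
  have II: "I * I = - 1" "I * (I * p) = - p" for p
    by (simp_all add: I_def pconst_uminus flip: pconst_mult mult.assoc)
  have "\<i> * cnj rot = rot"
    using rot_square by (metis mult.assoc mult.right_neutral rot_cnj)
  then have "I * pzbar = pconst rot * (px - I * py)"
    by (metis I_def mult.assoc pconst_mult pzbar_eq)
  then have "pz - I * pzbar = pconst (2 * rot) * (I * py)"
    by (simp add: pz_eq I_def pconst_mult pconst_numeral algebra_simps)
  then have "I * (pz - I * pzbar) = pconst (2 * rot) * (I * (I * py))"
    by (simp only: mult.left_commute[of I "pconst (2 * rot)"])
  then have "I * (pz - I * pzbar) = pconst (- 2 * rot) * py"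
    by (simp add: II pconst_uminus)
  moreover have "pzbar * pz = px\<^sup>2 + py\<^sup>2"
  proof -
    have "pzbar * pz = pconst (rot * cnj rot) * ((px - I * py) * (px + I * py))"
      unfolding pz_eq pzbar_eq I_def pconst_mult by (simp add: ac_simps)
    then show ?thesis
      by (simp add: rot_cnj algebra_simps power2_eq_square II)
  qed
  ultimately show ?thesis
    by (simp add: qLC_def line_circle_def mult.assoc flip: I_def)
qed

text \<open>
  The next two identities put \<open>x R\<close> and \<open>(y\<^sup>2 + t + u) R\<close> into the ideal of \<open>F\<close> and \<open>G\<close> with cofactors of
  degree one and two. The second follows from \<open>(3 x\<^sup>2 - y\<^sup>2 - t - u) R = (x\<^sup>2 + y\<^sup>2 - u) G\<close>, which holds
  since \<open>y\<close> divides both \<open>G\<close> and \<open>R\<close>, and from the first.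
\<close>
lemma px_line_circle: "2 * (px * line_circle u) = px * q7_im u t - py * q7_re u t"
  by (simp add: line_circle_def q7_im_def q7_re_def algebra_simps power2_eq_square power3_eq_cube pconst_add pconst_minus)

lemma py_line_circle: "2 * (py\<^sup>2 * line_circle u + pconst (of_real (t + u)) * line_circle u)
    = (3 * px\<^sup>2 - 2 * (px\<^sup>2 + py\<^sup>2 - pconst (of_real u))) * q7_im u t - 3 * px * py * q7_re u t"
  by (simp add: line_circle_def q7_im_def q7_re_def algebra_simps power2_eq_square power3_eq_cube pconst_add pconst_minus)

text \<open>
  The relations \<open>F\<close>, \<open>G\<close>, \<open>R\<close> solved for \<open>y\<^sup>3\<close>, \<open>x\<^sup>2 y\<close> and \<open>x\<^sup>3\<close>. They reduce every monomial to
  one of \<open>1, x, y, x\<^sup>2, x y, y\<^sup>2, x y\<^sup>2\<close>.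
\<close>
lemma py_cubed: "4 * py ^ 3 = 3 * line_circle u - q7_im u t + pconst (of_real (2 * u - t)) * py"
  by (simp add: line_circle_def q7_im_def algebra_simps power2_eq_square power3_eq_cube pconst_add pconst_minus pconst_mult pconst_numeral)

lemma px2_py: "4 * (px\<^sup>2 * py) = line_circle u + q7_im u t + pconst (of_real (2 * u + t)) * py"
  by (simp add: line_circle_def q7_im_def algebra_simps power2_eq_square power3_eq_cube pconst_add pconst_minus pconst_mult pconst_numeral)

lemma px_cubed: "px ^ 3 = q7_re u t + (3 * px * py\<^sup>2 + pconst (of_real (t - u)) * px)"
  by (simp add: q7_re_def)

lemma deg_le_q7_re: "deg_le 3 (q7_re u t)"
  and deg_le_q7_im: "deg_le 3 (q7_im u t)"
  and deg_le_line_circle: "deg_le 3 (line_circle u)"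
proof -
  have mon: "deg_le 3 (pconst c * (px ^ i * py ^ j))" if "i + j \<le> 3" for i j c
    using that by (intro deg_le_pconst_mult deg_le_px_py)
  have "q7_re u t = pconst 1 * (px ^ 3 * py ^ 0) - pconst 3 * (px ^ 1 * py ^ 2)
      - pconst (of_real (t - u)) * (px ^ 1 * py ^ 0)"
    by (simp add: q7_re_def pconst_numeral mult.assoc)
  then show "deg_le 3 (q7_re u t)"
    by (auto simp only: intro!: deg_le_diff mon)
  have "q7_im u t = pconst 3 * (px ^ 2 * py ^ 1) - pconst 1 * (px ^ 0 * py ^ 3)
      - pconst (of_real (t + u)) * (px ^ 0 * py ^ 1)"
    by (simp add: q7_im_def pconst_numeral mult.assoc)
  then show "deg_le 3 (q7_im u t)"
    by (auto simp only: intro!: deg_le_diff mon)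
  have "line_circle u = pconst 1 * (px ^ 2 * py ^ 1) + pconst 1 * (px ^ 0 * py ^ 3)
      - pconst (of_real u) * (px ^ 0 * py ^ 1)"
    by (simp add: line_circle_def algebra_simps power2_eq_square power3_eq_cube)
  then show "deg_le 3 (line_circle u)"
    by (auto simp only: intro!: deg_le_diff deg_le_add mon)
qed

section \<open>Zeros of the harmonic cubic\<close>

text \<open>
  At a zero with \<open>x \<noteq> 0\<close> the identity \<open>2 x R = x G - y F\<close> gives \<open>R = 0\<close>; for \<open>x = 0\<close> the equation
  \<open>G = 0\<close> reads \<open>y (y\<^sup>2 + t + u) = 0\<close>, and \<open>t + u > 0\<close> leaves only \<open>y = 0\<close>.
\<close>
lemma q7_zero_imp_qLC_zero:
  assumes "0 < \<bar>u\<bar>" "\<bar>u\<bar> < t" and zero: "peval (q7 u t) z = 0"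
  shows "peval (qLC u) z = 0"
proof -
  obtain a b where z: "z = point a b"
    by (rule point_cases)
  have "rot \<noteq> 0"
    using rot_cnj by auto
  with zero have "complex_of_real (a ^ 3 - 3 * a * b\<^sup>2 - (t - u) * a)
      + \<i> * complex_of_real (3 * a\<^sup>2 * b - b ^ 3 - (t + u) * b) = 0"
    by (simp add: q7_eq q7_re_def q7_im_def z)
  then have P: "a ^ 3 - 3 * a * b\<^sup>2 - (t - u) * a = 0" and Q: "3 * a\<^sup>2 * b - b ^ 3 - (t + u) * b = 0"
    by (simp_all add: complex_eq_iff del: of_real_diff of_real_mult)
  have "b * (a\<^sup>2 + b\<^sup>2 - u) = 0"
  proof (cases "a = 0")
    case True
    then have "b * (b\<^sup>2 + (t + u)) = 0"
      using Q by (simp add: algebra_simps power3_eq_cube power2_eq_square)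
    moreover have "b\<^sup>2 + (t + u) > 0"
      using assms(2) abs_ge_minus_self[of u] zero_le_power2[of b] by linarith
    ultimately show ?thesis
      by simp
  next
    case False
    have "2 * (a * (b * (a\<^sup>2 + b\<^sup>2 - u))) = a * (3 * a\<^sup>2 * b - b ^ 3 - (t + u) * b)
        - b * (a ^ 3 - 3 * a * b\<^sup>2 - (t - u) * a)"
      by (simp add: algebra_simps power3_eq_cube power2_eq_square)
    then show ?thesis
      using P Q False by simp
  qed
  moreover have "peval (qLC u) z = - 2 * rot * complex_of_real (b * (a\<^sup>2 + b\<^sup>2 - u))"
    by (simp add: qLC_eq line_circle_def z)
  ultimately show ?thesis
    by (simp only: of_real_0 mult_zero_right)
qed

section \<open>Column relations in terms of moments\<close>

text \<open>As \<open>\<Lambda>\<close> is Hermitian, the conjugate \<open>F - \<i> G\<close> satisfies the same relation as \<open>F + \<i> G\<close>.\<close>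
lemma annihilates_q7_re_im:
  assumes herm: "hermitian_upto 6 \<gamma>" and q7: "annihilates \<gamma> 3 (q7 u t)"
  shows "annihilates \<gamma> 3 (q7_re u t)" "annihilates \<gamma> 3 (q7_im u t)"
proof -
  have r3: "cnj rot ^ 3 * rot ^ 3 = 1"
    using rot_cnj by (metis mult.commute power_mult_distrib power_one)
  let ?S = "q7_re u t + pconst \<i> * q7_im u t" and ?D = "q7_re u t - pconst \<i> * q7_im u t"
  have "annihilates \<gamma> 3 (pconst (cnj rot ^ 3) * q7 u t)"
    by (rule annihilates_pconst_mult[OF q7])
  moreover have "pconst (cnj rot ^ 3) * q7 u t = ?S"
    unfolding q7_eq by (simp add: r3 flip: mult.assoc pconst_mult)
  ultimately have S: "annihilates \<gamma> 3 ?S"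
    by simp
  have "deg_le 3 ?S"
    by (intro deg_le_add deg_le_pconst_mult deg_le_q7_re deg_le_q7_im)
  with herm S have "annihilates \<gamma> 3 (pconj ?S)"
    by (rule annihilates_pconj) simp
  moreover have "pconj ?S = ?D"
    by (simp add: q7_re_def q7_im_def pconst_uminus)
  ultimately have D: "annihilates \<gamma> 3 ?D"
    by simp
  have "pconst (1 / 2) * (?S + ?D) = pconst (1 / 2 + 1 / 2) * q7_re u t"
    by (simp only: pconst_add) (simp add: algebra_simps)
  then have "pconst (1 / 2) * (?S + ?D) = q7_re u t"
    by simp
  then show "annihilates \<gamma> 3 (q7_re u t)"
    using annihilates_pconst_mult[OF annihilates_add[OF S D], of "1 / 2"] by simp
  have "pconst (- \<i> / 2) * (?S - ?D) = pconst (- \<i> / 2 * \<i> + - \<i> / 2 * \<i>) * q7_im u t"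
    by (simp only: pconst_mult pconst_add) (simp add: algebra_simps)
  then have "pconst (- \<i> / 2) * (?S - ?D) = q7_im u t"
    by simp
  then show "annihilates \<gamma> 3 (q7_im u t)"
    using annihilates_pconst_mult[OF annihilates_diff[OF S D], of "- \<i> / 2"] by simp
qed

text \<open>
  It suffices to test the multipliers \<open>x\<^sup>i y\<^sup>j\<close>. Those divisible by \<open>x\<close> are covered by \<open>2 x R = x G - y F\<close>;
  for the powers of \<open>y\<close>, the relation \<open>y\<^sup>2 R = - (t + u) R\<close> modulo \<open>F\<close> and \<open>G\<close> leads back to \<open>R\<close> and \<open>y R\<close>.
\<close>
lemma annihilates_line_circle:
  assumes P: "annihilates \<gamma> 3 (q7_re u t)" and Q: "annihilates \<gamma> 3 (q7_im u t)"
    and R: "riesz \<gamma> (line_circle u) = 0" and yR: "riesz \<gamma> (py * line_circle u) = 0"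
  shows "annihilates \<gamma> 3 (line_circle u)"
proof (rule annihilates_if_px_py)
  have x: "riesz \<gamma> (m * (px * line_circle u)) = 0" if "deg_le 2 m" for m
  proof -
    have "2 * (m * (px * line_circle u)) = (m * px) * q7_im u t - (m * py) * q7_re u t"
      using px_line_circle[of u t] by (metis (no_types, lifting) mult.assoc mult.left_commute right_diff_distrib)
    moreover have "deg_le 3 (m * px)" "deg_le 3 (m * py)"
      using deg_le_mult[OF that deg_le_px] deg_le_mult[OF that deg_le_py] by simp_all
    ultimately have "2 * riesz \<gamma> (m * (px * line_circle u)) = 0"
      using P Q by (metis annihilatesD diff_self riesz_diff riesz_numeral_mult)
    then show ?thesis
      by simp
  qed
  have y: "riesz \<gamma> (m * (py\<^sup>2 * line_circle u)) = - of_real (t + u) * riesz \<gamma> (m * line_circle u)" if "deg_le 1 m" for m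
  proof -
    \<comment> \<open>The cofactors of \<open>G\<close> and \<open>- F\<close>, of degree two: together with \<open>m\<close> the multipliers have degree three.\<close>
    let ?a = "3 * px\<^sup>2 - 2 * (px\<^sup>2 + py\<^sup>2 - pconst (of_real u))" and ?b = "3 * px * py"
    have "2 * (m * (py\<^sup>2 * line_circle u) + pconst (of_real (t + u)) * (m * line_circle u))
        = m * (2 * (py\<^sup>2 * line_circle u + pconst (of_real (t + u)) * line_circle u))"
      by (simp add: algebra_simps)
    also have "\<dots> = (m * ?a) * q7_im u t - (m * ?b) * q7_re u t"
      unfolding py_line_circle by (simp add: algebra_simps)
    finally have eq: "2 * (m * (py\<^sup>2 * line_circle u) + pconst (of_real (t + u)) * (m * line_circle u))
        = (m * ?a) * q7_im u t - (m * ?b) * q7_re u t" .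
    have sq: "deg_le 2 (px\<^sup>2)" "deg_le 2 (py\<^sup>2)" "deg_le 2 (px * py)"
      using deg_le_px_py[of 2 0 2] deg_le_px_py[of 0 2 2] deg_le_px_py[of 1 1 2] by simp_all
    have num: "deg_le 2 (numeral k * p)" if "deg_le 2 p" for k p
      using deg_le_mult[OF deg_le_numeral that, of 0] by (simp only: add_0)
    have "deg_le 2 ?a" "deg_le 2 ?b"
      by (auto simp: mult.assoc intro!: num sq deg_le_diff deg_le_add)
    moreover have "deg_le 3 (m * q)" if "deg_le 2 q" for q
      using deg_le_mono[OF deg_le_mult[OF \<open>deg_le 1 m\<close> that], of 3] by simp
    ultimately have "deg_le 3 (m * ?a)" "deg_le 3 (m * ?b)"
      by blast+
    then have "riesz \<gamma> ((m * ?a) * q7_im u t - (m * ?b) * q7_re u t) = 0"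
      using P Q by (simp only: riesz_diff annihilatesD) simp
    then have "2 * (riesz \<gamma> (m * (py\<^sup>2 * line_circle u)) + of_real (t + u) * riesz \<gamma> (m * line_circle u)) = 0"
      unfolding eq[symmetric] by (simp only: riesz_linear)
    then show ?thesis
      by (simp only: eq_neg_iff_add_eq_0 mult_minus_left mult_eq_0_iff) simp
  qed
  fix i j :: nat
  assume ij: "i + j \<le> 3"
  show "riesz \<gamma> (px ^ i * py ^ j * line_circle u) = 0"
  proof (cases i)
    case (Suc i')
    then have eq: "px ^ i * py ^ j * line_circle u = (px ^ i' * py ^ j) * (px * line_circle u)"
      by (simp add: algebra_simps)
    show ?thesis
      unfolding eq by (rule x[OF deg_le_px_py]) (use ij Suc in simp)
  next
    case 0
    have "riesz \<gamma> (py\<^sup>2 * line_circle u) = 0"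
      using y[of 1] R by simp
    moreover have "riesz \<gamma> (py ^ 3 * line_circle u) = 0"
      using y[OF deg_le_py] yR by (simp add: power3_eq_cube power2_eq_square mult.assoc)
    ultimately show ?thesis
      using 0 ij R yR by (cases "j = 0 \<or> j = 1 \<or> j = 2 \<or> j = 3") auto
  qed
qed

lemma riesz_qLC_iff_annihilates:
  assumes P: "annihilates \<gamma> 3 (q7_re u t)" and Q: "annihilates \<gamma> 3 (q7_im u t)"
  shows "riesz \<gamma> (qLC u) = 0 \<and> riesz \<gamma> (pz * qLC u) = 0 \<longleftrightarrow> annihilates \<gamma> 3 (qLC u)"
proof
  assume ii: "riesz \<gamma> (qLC u) = 0 \<and> riesz \<gamma> (pz * qLC u) = 0"
  have rot: "rot \<noteq> 0"
    using rot_cnj by auto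
  have R: "riesz \<gamma> (line_circle u) = 0"
    using ii rot by (simp add: qLC_eq riesz_linear)
  have "2 * riesz \<gamma> (px * line_circle u) = riesz \<gamma> (px * q7_im u t - py * q7_re u t)"
    by (simp only: px_line_circle[symmetric] riesz_linear)
  also have "\<dots> = 0"
    using annihilatesD[OF P] annihilatesD[OF Q] deg_le_px deg_le_py
    by (simp add: riesz_diff deg_le_mono[of 1 _ 3])
  finally have xR: "riesz \<gamma> (px * line_circle u) = 0"
    by simp
  have "pz * qLC u = pconst (- 2 * rot) * (pconst rot * (px * line_circle u + pconst \<i> * (py * line_circle u)))"
    by (simp add: qLC_eq pz_eq algebra_simps)
  then have "riesz \<gamma> (pz * qLC u) = - 2 * rot * (rot * (riesz \<gamma> (px * line_circle u) + \<i> * riesz \<gamma> (py * line_circle u)))"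
    by (simp only: riesz_linear)
  then have "riesz \<gamma> (py * line_circle u) = 0"
    using ii rot by (simp add: xR)
  from annihilates_pconst_mult[OF annihilates_line_circle[OF P Q R this]]
  show "annihilates \<gamma> 3 (qLC u)"
    by (simp only: qLC_eq)
next
  assume "annihilates \<gamma> 3 (qLC u)"
  then show "riesz \<gamma> (qLC u) = 0 \<and> riesz \<gamma> (pz * qLC u) = 0"
    using annihilatesD[of \<gamma> 3 "qLC u" 1] annihilatesD[of \<gamma> 3 "qLC u" pz] deg_le_mono[OF deg_le_pz, of 3]
    by simp
qed

lemma annihilates_line_circle_if_qLC:
  assumes "annihilates \<gamma> n (qLC u)"
  shows "annihilates \<gamma> n (line_circle u)"
proof -
  have "pconst (- cnj rot / 2) * qLC u = pconst ((- cnj rot / 2) * (- 2 * rot)) * line_circle u"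
    by (simp only: qLC_eq pconst_mult mult.assoc)
  also have "(- cnj rot / 2) * (- 2 * rot) = 1"
    using rot_cnj by (simp add: mult.commute)
  finally show ?thesis
    using annihilates_pconst_mult[OF assms, of "- cnj rot / 2"] by simp
qed

text \<open>
  The first condition carries a common factor \<open>1 + \<i>\<close>. In the second one \<open>\<gamma>\<^sub>1\<^sub>3\<close> occurs, which the
  row of \<open>z\<close> in the column relation for \<open>q7\<close> expresses in moments of degree two.
\<close>
lemma riesz_qLC_moments:
  assumes herm: "hermitian_upto 6 \<gamma>" and q7: "annihilates \<gamma> 3 (q7 u t)"
  shows "riesz \<gamma> (qLC u) = 0 \<and> riesz \<gamma> (pz * qLC u) = 0 \<longleftrightarrow>
    Re (\<gamma> 1 2) - Im (\<gamma> 1 2) = u * (Re (\<gamma> 0 1) - Im (\<gamma> 0 1)) \<and>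
    \<gamma> 2 2 = of_real (t + u) * \<gamma> 1 1 - of_real (2 * u * Im (\<gamma> 0 2))"
proof -
  have mon: "riesz \<gamma> (pzbar ^ i * pz ^ j) = \<gamma> i j" for i j
    using riesz_single[of \<gamma> i j 1] by (simp add: single_eq_pconst)
  note mons = mon[of 0 1, simplified] mon[of 1 0, simplified] mon[of 1 1, simplified] mon[of 0 2, simplified]
    mon[of 1 2, simplified] mon[of 2 1, simplified] mon[of 2 2, simplified] mon[of 1 3, simplified]
    mon[of 2 0, simplified]
  have h: "\<gamma> j i = cnj (\<gamma> i j)" if "i + j \<le> 6" for i j
    using herm that unfolding hermitian_upto_def by blast
  have h1: "\<gamma> 1 0 = cnj (\<gamma> 0 1)" "\<gamma> 2 1 = cnj (\<gamma> 1 2)" "\<gamma> 2 0 = cnj (\<gamma> 0 2)"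
    by (rule h; simp)+
  have "riesz \<gamma> (qLC u) = riesz \<gamma> (pzbar\<^sup>2 * pz + pconst \<i> * (pzbar * pz\<^sup>2)
      - pconst (of_real u) * pzbar - pconst (\<i> * of_real u) * pz)"
    by (simp only: qLC_expand mult.assoc)
  also have "\<dots> = \<gamma> 2 1 + \<i> * \<gamma> 1 2 - of_real u * \<gamma> 1 0 - \<i> * of_real u * \<gamma> 0 1"
    by (simp only: riesz_linear mons One_nat_def)
  finally have "riesz \<gamma> (qLC u)
      = (1 + \<i>) * of_real (Re (\<gamma> 1 2) - Im (\<gamma> 1 2) - u * (Re (\<gamma> 0 1) - Im (\<gamma> 0 1)))"
    unfolding h1 by (simp add: complex_eq_iff algebra_simps)
  moreover have "1 + \<i> \<noteq> 0"
    by (simp add: complex_eq_iff)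
  ultimately have first: "riesz \<gamma> (qLC u) = 0 \<longleftrightarrow>
      Re (\<gamma> 1 2) - Im (\<gamma> 1 2) = u * (Re (\<gamma> 0 1) - Im (\<gamma> 0 1))"
    by (auto simp del: of_real_diff of_real_mult)
  have "riesz \<gamma> (pzbar * q7 u t) = 0"
    by (rule annihilatesD[OF q7]) (rule deg_le_mono[OF deg_le_pzbar], simp)
  moreover have "pzbar * q7 u t
      = pzbar * pz ^ 3 - pconst (\<i> * of_real t) * (pzbar * pz) - pconst (of_real u) * pzbar\<^sup>2"
    by (simp add: q7_def algebra_simps power2_eq_square)
  ultimately have g13: "\<gamma> 1 3 = \<i> * of_real t * \<gamma> 1 1 + of_real u * \<gamma> 2 0"
    by (simp only: riesz_linear mons One_nat_def) (simp add: algebra_simps)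
  have "pz * qLC u = pzbar\<^sup>2 * pz\<^sup>2 + pconst \<i> * (pzbar * pz ^ 3)
      - pconst (of_real u) * (pzbar * pz) - pconst (\<i> * of_real u) * pz\<^sup>2"
    by (simp add: qLC_expand algebra_simps power2_eq_square power3_eq_cube)
  then have "riesz \<gamma> (pz * qLC u) = \<gamma> 2 2 + \<i> * \<gamma> 1 3 - of_real u * \<gamma> 1 1 - \<i> * of_real u * \<gamma> 0 2"
    by (simp only: riesz_linear mons One_nat_def)
  then have "riesz \<gamma> (pz * qLC u)
      = \<gamma> 2 2 - (of_real (t + u) * \<gamma> 1 1 - of_real (2 * u * Im (\<gamma> 0 2)))"
    unfolding g13 h1 by (simp add: complex_eq_iff algebra_simps)
  with first show ?thesis
    by auto
qed

section \<open>Moments annihilated by all three cubics\<close>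

lemma moment_recurrences:
  assumes P: "annihilates \<gamma> 3 (q7_re u t)" and Q: "annihilates \<gamma> 3 (q7_im u t)"
    and R: "annihilates \<gamma> 3 (line_circle u)" and ij: "i + j \<le> 3"
  shows "4 * riesz \<gamma> (px ^ i * py ^ (j + 3)) = of_real (2 * u - t) * riesz \<gamma> (px ^ i * py ^ (j + 1))"
    and "4 * riesz \<gamma> (px ^ (i + 2) * py ^ (j + 1)) = of_real (2 * u + t) * riesz \<gamma> (px ^ i * py ^ (j + 1))"
    and "riesz \<gamma> (px ^ (i + 3) * py ^ j)
      = 3 * riesz \<gamma> (px ^ (i + 1) * py ^ (j + 2)) + of_real (t - u) * riesz \<gamma> (px ^ (i + 1) * py ^ j)"
proof -
  define m where "m = px ^ i * py ^ j"
  have "deg_le 3 m"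
    unfolding m_def by (rule deg_le_px_py[OF ij])
  then have 0: "riesz \<gamma> (m * q7_re u t) = 0" "riesz \<gamma> (m * q7_im u t) = 0" "riesz \<gamma> (m * line_circle u) = 0"
    using P Q R by (simp_all add: annihilatesD)
  have "4 * (px ^ i * py ^ (j + 3)) = m * (4 * py ^ 3)"
    by (simp add: m_def power_add algebra_simps)
  also have "\<dots> = 3 * (m * line_circle u) - m * q7_im u t + pconst (of_real (2 * u - t)) * (px ^ i * py ^ (j + 1))"
    unfolding py_cubed[of u t] by (simp add: m_def algebra_simps)
  finally have "riesz \<gamma> (4 * (px ^ i * py ^ (j + 3))) = riesz \<gamma> \<dots>"
    by simp
  then show "4 * riesz \<gamma> (px ^ i * py ^ (j + 3)) = of_real (2 * u - t) * riesz \<gamma> (px ^ i * py ^ (j + 1))"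
    by (simp only: riesz_linear 0) simp
  have "4 * (px ^ (i + 2) * py ^ (j + 1)) = m * (4 * (px\<^sup>2 * py))"
    by (simp add: m_def power_add algebra_simps power2_eq_square)
  also have "\<dots> = m * line_circle u + m * q7_im u t + pconst (of_real (2 * u + t)) * (px ^ i * py ^ (j + 1))"
    unfolding px2_py[of u t] by (simp add: m_def algebra_simps)
  finally have "riesz \<gamma> (4 * (px ^ (i + 2) * py ^ (j + 1))) = riesz \<gamma> \<dots>"
    by simp
  then show "4 * riesz \<gamma> (px ^ (i + 2) * py ^ (j + 1)) = of_real (2 * u + t) * riesz \<gamma> (px ^ i * py ^ (j + 1))"
    by (simp only: riesz_linear 0) simp
  have "px ^ (i + 3) * py ^ j = m * px ^ 3"
    by (simp add: m_def power_add algebra_simps)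
  also have "\<dots> = m * q7_re u t + 3 * (px ^ (i + 1) * py ^ (j + 2))
      + pconst (of_real (t - u)) * (px ^ (i + 1) * py ^ j)"
    unfolding px_cubed[of u t] by (simp add: m_def power_add algebra_simps power2_eq_square)
  finally have "riesz \<gamma> (px ^ (i + 3) * py ^ j) = riesz \<gamma> \<dots>"
    by simp
  then show "riesz \<gamma> (px ^ (i + 3) * py ^ j)
      = 3 * riesz \<gamma> (px ^ (i + 1) * py ^ (j + 2)) + of_real (t - u) * riesz \<gamma> (px ^ (i + 1) * py ^ j)"
    by (simp only: riesz_linear 0) simp
qed

text \<open>
  Entries with \<open>j \<ge> 1\<close> are reduced first: the first two recurrences lower the degree by two and keep
  \<open>j \<ge> 1\<close>. Only then can the third one, whose right-hand side contains an entry of the same degree,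
  be used for \<open>j = 0\<close>.
\<close>
lemma recurrences_eq_0:
  fixes e :: "nat \<Rightarrow> nat \<Rightarrow> complex"
  assumes rec1: "\<And>i j. i + j \<le> 3 \<Longrightarrow> 4 * e i (j + 3) = c1 * e i (j + 1)"
    and rec2: "\<And>i j. i + j \<le> 3 \<Longrightarrow> 4 * e (i + 2) (j + 1) = c2 * e i (j + 1)"
    and rec3: "\<And>i j. i + j \<le> 3 \<Longrightarrow> e (i + 3) j = 3 * e (i + 1) (j + 2) + c3 * e (i + 1) j"
    and base: "e 0 0 = 0" "e 1 0 = 0" "e 0 1 = 0" "e 2 0 = 0" "e 1 1 = 0" "e 0 2 = 0" "e 1 2 = 0"
  shows "i + j \<le> 6 \<Longrightarrow> e i j = 0"
proof -
  have pos: "e i j = 0" if "i + j \<le> 6" "1 \<le> j" for i j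
    using that
  proof (induction "i + j" arbitrary: i j rule: less_induct)
    case less
    consider "j \<ge> 3" | "i \<ge> 2" "j \<le> 2" | "i \<le> 1" "j \<le> 2"
      by linarith
    then show ?case
    proof cases
      case 1
      then have "e i (j - 3 + 1) = 0"
        using less by simp
      then show ?thesis
        using rec1[of i "j - 3"] less.prems 1 by simp
    next
      case 2
      then have "e (i - 2) (j - 1 + 1) = 0"
        using less by simp
      moreover have "i - 2 + 2 = i" "j - 1 + 1 = j"
        using 2 less.prems by simp_all
      ultimately show ?thesis
        using rec2[of "i - 2" "j - 1"] less.prems 2 by simp
    next
      case 3
      then have "(i = 0 \<or> i = 1) \<and> (j = 1 \<or> j = 2)"
        using less.prems by linarith
      then show ?thesis
        using base by auto
    qed
  qed
  have zero: "e i 0 = 0" if "i \<le> 6" for i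
    using that
  proof (induction i rule: less_induct)
    case (less i)
    show ?case
    proof (cases "i \<le> 2")
      case True
      then have "i = 0 \<or> i = 1 \<or> i = 2"
        by linarith
      then show ?thesis
        using base by auto
    next
      case False
      then have "e (i - 3 + 1) (0 + 2) = 0" "e (i - 3 + 1) 0 = 0" "i - 3 + 3 = i" "i - 3 + 0 \<le> 3"
        using less by (auto intro: pos)
      then show ?thesis
        using rec3[of "i - 3" 0] by (simp only:) simp
    qed
  qed
  show "i + j \<le> 6 \<Longrightarrow> e i j = 0"
    using pos zero by (cases j) auto
qed

text \<open>
  This is where the definiteness of \<open>M(2)\<close> enters: if \<open>2 u < t\<close>, then \<open>4 \<Lambda>(y\<^sup>4) = (2 u - t) \<Lambda>(y\<^sup>2)\<close>
  with \<open>\<Lambda>(y\<^sup>4), \<Lambda>(y\<^sup>2) \<ge> 0\<close> forces \<open>\<Lambda>(y\<^sup>2) = 0\<close>, so \<open>y\<close> would be a column relation of \<open>M(2)\<close>.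
\<close>
lemma half_t_le_u:
  assumes herm: "hermitian_upto 6 \<gamma>" and psd: "psd_mat (moment_matrix \<gamma> 3)"
    and pd: "pd_mat (moment_matrix \<gamma> 2)"
    and P: "annihilates \<gamma> 3 (q7_re u t)" and Q: "annihilates \<gamma> 3 (q7_im u t)" and R: "annihilates \<gamma> 3 (line_circle u)"
  shows "0 \<le> 2 * u - t"
proof (rule ccontr)
  assume neg: "\<not> 0 \<le> 2 * u - t"
  have "pconj py * py = py\<^sup>2" "pconj (py\<^sup>2) * py\<^sup>2 = py ^ 4"
    using power_add[of py 2 2] by (simp_all add: power2_eq_square)
  then have "0 \<le> riesz \<gamma> (py\<^sup>2)" "0 \<le> riesz \<gamma> (py ^ 4)"
    using riesz_square_nonneg[OF psd, of py] riesz_square_nonneg[OF psd, of "py\<^sup>2"]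
      deg_le_px_py[of 0 1 3] deg_le_px_py[of 0 2 3] by simp_all
  then have nonneg: "0 \<le> Re (riesz \<gamma> (py\<^sup>2))" "Im (riesz \<gamma> (py\<^sup>2)) = 0" "0 \<le> Re (riesz \<gamma> (py ^ 4))"
    by (simp_all add: less_eq_complex_def)
  have "4 * riesz \<gamma> (py ^ 4) = of_real (2 * u - t) * riesz \<gamma> (py\<^sup>2)"
    using moment_recurrences(1)[OF P Q R, of 0 1] by (simp add: numeral_eq_Suc)
  then have "4 * Re (riesz \<gamma> (py ^ 4)) = (2 * u - t) * Re (riesz \<gamma> (py\<^sup>2))"
    by (simp add: complex_eq_iff)
  with nonneg neg have "riesz \<gamma> (py\<^sup>2) = 0"
    by (smt (verit) complex_eq_iff mult_neg_pos zero_complex.sel)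
  then have "riesz \<gamma> (pconj py * py) = 0"
    by (simp add: power2_eq_square)
  moreover have "hermitian_upto (2 * 2) \<gamma>"
    by (rule hermitian_upto_mono[OF herm]) simp
  moreover have py: "deg_le 2 py"
    using deg_le_mono[OF deg_le_py] by simp
  ultimately have "annihilates \<gamma> 2 py"
    using annihilates_if_riesz_square_eq_0[of \<gamma> 2 py] pd by (simp add: pd_mat_def)
  moreover have "py \<noteq> 0"
  proof
    assume "py = 0"
    then have "peval py (point 0 1) = 0"
      by (simp only: peval_0)
    then show False
      by simp
  qed
  ultimately show False
    using not_annihilates_if_pd[OF pd py] by blast
qed

section \<open>Cubature on the seven common zeros\<close>

text \<open>In rotated coordinates \<open>(x, y)\<close>; the radicands are nonnegative exactly for \<open>|t| / 2 \<le> u \<le> t\<close>.\<close>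
definition common_zeros :: "real \<Rightarrow> real \<Rightarrow> (real \<times> real) set"
  where "common_zeros u t = insert (0, 0)
    ({- sqrt (t - u), sqrt (t - u)} \<times> {0} \<union>
     {- sqrt ((2 * u + t) / 4), sqrt ((2 * u + t) / 4)} \<times> {- sqrt ((2 * u - t) / 4), sqrt ((2 * u - t) / 4)})"

text \<open>
  With nodes \<open>(0, 0)\<close>, \<open>(\<plusminus>\<surd>A, 0)\<close> and \<open>(\<plusminus>\<surd>X, \<plusminus>\<surd>Y)\<close>: at a grid point \<open>(a, b)\<close> the polynomial is
  \<open>y (y + b) (x + a) / (4 a b\<^sup>2)\<close>; at a point of the axis it has the even part
  \<open>(x\<^sup>2 - X y\<^sup>2 / Y) / (2 A)\<close> and the odd part \<open>x (Y - y\<^sup>2) / (2 a Y)\<close>; at the origin it is the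
  equation of the conic through the six other nodes, normalized to constant term \<open>1\<close>.
\<close>
definition lagrange :: "real \<Rightarrow> real \<Rightarrow> real \<times> real \<Rightarrow> zpoly"
  where "lagrange u t = (\<lambda>(a, b).
    let A = t - u; X = (2 * u + t) / 4; Y = (2 * u - t) / 4 in
    if b \<noteq> 0 then
      pconst (of_real (1 / (4 * a * Y)))
        * (px * py\<^sup>2 + pconst (of_real b) * (px * py) + pconst (of_real a) * py\<^sup>2
            + pconst (of_real (a * b)) * py)
    else if a \<noteq> 0 then
      pconst (of_real (1 / (2 * A))) * (px\<^sup>2 - pconst (of_real (X / Y)) * py\<^sup>2)
        + pconst (of_real (1 / (2 * a * Y))) * (pconst (of_real Y) * px - px * py\<^sup>2)
    else
      1 - pconst (of_real (1 / A)) * px\<^sup>2 - pconst (of_real ((1 - X / A) / Y)) * py\<^sup>2)"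

lemma finite_common_zeros: "finite (common_zeros u t)"
  by (simp add: common_zeros_def)

lemma deg_le_lagrange: "deg_le 3 (lagrange u t k)"
proof -
  have mon: "deg_le 3 px" "deg_le 3 py" "deg_le 3 (px * py)" "deg_le 3 (px\<^sup>2)" "deg_le 3 (py\<^sup>2)" "deg_le 3 (px * py\<^sup>2)"
    using deg_le_px_py[of 1 0 3] deg_le_px_py[of 0 1 3] deg_le_px_py[of 1 1 3] deg_le_px_py[of 2 0 3]
      deg_le_px_py[of 0 2 3] deg_le_px_py[of 1 2 3] by simp_all
  show ?thesis
    by (auto simp: lagrange_def Let_def split: prod.split
        intro!: deg_le_add deg_le_diff deg_le_pconst_mult mon)
qed

lemma peval_lagrange:
  assumes "0 < u" "u < t" "t < 2 * u" "k \<in> common_zeros u t" "l \<in> common_zeros u t"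
  shows "peval (lagrange u t k) (case l of (a, b) \<Rightarrow> point a b) = (if k = l then 1 else 0)"
proof -
  define a0 where "a0 = sqrt (t - u)"
  define a1 where "a1 = sqrt ((2 * u + t) / 4)"
  define b1 where "b1 = sqrt ((2 * u - t) / 4)"
  have pos: "a0 > 0" "a1 > 0" "b1 > 0"
    using assms by (simp_all add: a0_def a1_def b1_def)
  have sq: "t - u = a0\<^sup>2" "(2 * u + t) / 4 = a1\<^sup>2" "(2 * u - t) / 4 = b1\<^sup>2"
    using assms by (simp_all add: a0_def a1_def b1_def)
  obtain a b c d where kl: "k = (a, b)" "l = (c, d)"
    by (cases k, cases l) auto
  define f where "f = (if b \<noteq> 0 then 1 / (4 * a * b1\<^sup>2) * (c * d\<^sup>2 + b * (c * d) + a * d\<^sup>2 + (a * b) * d)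
    else if a \<noteq> 0 then 1 / (2 * a0\<^sup>2) * (c\<^sup>2 - a1\<^sup>2 / b1\<^sup>2 * d\<^sup>2) + 1 / (2 * a * b1\<^sup>2) * (b1\<^sup>2 * c - c * d\<^sup>2)
    else 1 - 1 / a0\<^sup>2 * c\<^sup>2 - (1 - a1\<^sup>2 / a0\<^sup>2) / b1\<^sup>2 * d\<^sup>2)"
  have "peval (lagrange u t k) (point c d) = of_real f"
    by (simp add: kl lagrange_def Let_def f_def sq)
  moreover have "f = (if k = l then 1 else 0)"
  proof -
    have cases: "a = 0 \<and> b = 0 \<or> (a = a0 \<or> a = - a0) \<and> b = 0 \<or> (a = a1 \<or> a = - a1) \<and> (b = b1 \<or> b = - b1)"
      if "(a, b) \<in> common_zeros u t" for a b
      using that unfolding common_zeros_def a0_def[symmetric] a1_def[symmetric] b1_def[symmetric] by blast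
    have nz: "a0 \<noteq> 0" "a1 \<noteq> 0" "b1 \<noteq> 0"
      using pos by simp_all
    show ?thesis
      using cases[OF assms(4)[unfolded kl]] cases[OF assms(5)[unfolded kl]] nz
      unfolding kl f_def prod.inject
      by (elim disjE conjE; hypsubst_thin; simp add: power2_eq_square; simp add: field_simps)
  qed
  ultimately show ?thesis
    by (simp add: kl)
qed

text \<open>
  The seven Lagrange polynomials span the reduced monomials: combining the four sign choices isolates
  each of \<open>x y\<^sup>2, x y, y\<^sup>2, y\<close>, the two points of the axis then give \<open>x\<^sup>2\<close> and \<open>x\<close>, and the origin gives
  \<open>1\<close>. The recurrences do the rest.
\<close>
lemma eq_0_if_lagrange_eq_0:
  assumes u: "0 < u" "u < t" "t < 2 * u"
    and P: "annihilates \<delta> 3 (q7_re u t)" and Q: "annihilates \<delta> 3 (q7_im u t)" and R: "annihilates \<delta> 3 (line_circle u)"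
    and L: "\<And>k. k \<in> common_zeros u t \<Longrightarrow> riesz \<delta> (lagrange u t k) = 0"
    and p: "deg_le 6 p"
  shows "riesz \<delta> p = 0"
proof (rule deg_le_riesz_eq_0[OF _ p])
  define a1 where "a1 = sqrt ((2 * u + t) / 4)"
  define b1 where "b1 = sqrt ((2 * u - t) / 4)"
  define Y where "Y = (2 * u - t) / 4"
  have pos: "a1 > 0" "b1 > 0" "Y > 0" "sqrt (t - u) > 0"
    using u by (simp_all add: a1_def b1_def Y_def)
  have grid: "riesz \<delta> (px * py\<^sup>2) + of_real b * riesz \<delta> (px * py) + of_real a * riesz \<delta> (py\<^sup>2)
      + of_real (a * b) * riesz \<delta> py = 0" if "a = a1 \<or> a = - a1" "b = b1 \<or> b = - b1" for a b
  proof -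
    have "(a, b) \<in> common_zeros u t" "a \<noteq> 0" "b \<noteq> 0"
      using that pos by (auto simp: common_zeros_def a1_def b1_def)
    with L[of "(a, b)"] pos(3) show ?thesis
      by (simp add: lagrange_def Let_def Y_def[symmetric] riesz_linear)
  qed
  have axis: "of_real (1 / (2 * (t - u))) * (riesz \<delta> (px\<^sup>2) - of_real ((2 * u + t) / 4 / Y) * riesz \<delta> (py\<^sup>2))
      + of_real (1 / (2 * a * Y)) * (of_real Y * riesz \<delta> px - riesz \<delta> (px * py\<^sup>2)) = 0"
    if "a = sqrt (t - u) \<or> a = - sqrt (t - u)" for a
  proof -
    have "(a, 0) \<in> common_zeros u t" "a \<noteq> 0"
      using that pos by (auto simp: common_zeros_def)
    with L[of "(a, 0)"] show ?thesis
      by (simp only: lagrange_def Let_def Y_def riesz_linear split if_False if_True simp_thms)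
  qed
  have origin: "riesz \<delta> 1 - of_real (1 / (t - u)) * riesz \<delta> (px\<^sup>2)
      - of_real ((1 - (2 * u + t) / 4 / (t - u)) / Y) * riesz \<delta> (py\<^sup>2) = 0"
  proof -
    have "(0, 0) \<in> common_zeros u t"
      by (simp add: common_zeros_def)
    from L[OF this] show ?thesis
      by (simp only: lagrange_def Let_def Y_def riesz_linear split if_False if_True simp_thms)
  qed
  have solve: "x1 = 0 \<and> x2 = 0 \<and> x3 = 0 \<and> x4 = 0"
    if "x1 + x2 + x3 + x4 = 0" "x1 - x2 + x3 - x4 = 0" "x1 + x2 - x3 - x4 = 0" "x1 - x2 - x3 + x4 = 0"
    for x1 x2 x3 x4 :: complex
  proof -
    \<comment> \<open>The four sign patterns form a Hadamard matrix, which inverts itself up to the factor \<open>4\<close>.\<close>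
    have "4 * x1 = (x1 + x2 + x3 + x4) + (x1 - x2 + x3 - x4) + (x1 + x2 - x3 - x4) + (x1 - x2 - x3 + x4)"
      "4 * x2 = (x1 + x2 + x3 + x4) - (x1 - x2 + x3 - x4) + (x1 + x2 - x3 - x4) - (x1 - x2 - x3 + x4)"
      "4 * x3 = (x1 + x2 + x3 + x4) + (x1 - x2 + x3 - x4) - (x1 + x2 - x3 - x4) - (x1 - x2 - x3 + x4)"
      "4 * x4 = (x1 + x2 + x3 + x4) - (x1 - x2 + x3 - x4) - (x1 + x2 - x3 - x4) + (x1 - x2 - x3 + x4)"
      by simp_all
    then show ?thesis
      unfolding that by simp
  qed
  have "riesz \<delta> (px * py\<^sup>2) = 0 \<and> of_real b1 * riesz \<delta> (px * py) = 0 \<and> of_real a1 * riesz \<delta> (py\<^sup>2) = 0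
      \<and> of_real (a1 * b1) * riesz \<delta> py = 0"
    using grid[of a1 b1] grid[of a1 "- b1"] grid[of "- a1" b1] grid[of "- a1" "- b1"]
    by (intro solve) simp_all
  then have off: "riesz \<delta> (px * py\<^sup>2) = 0" "riesz \<delta> (px * py) = 0" "riesz \<delta> (py\<^sup>2) = 0" "riesz \<delta> py = 0"
    using pos by auto
  have ax: "of_real (1 / (2 * (t - u))) * riesz \<delta> (px\<^sup>2) + of_real (1 / (2 * a)) * riesz \<delta> px = 0"
    if "a = sqrt (t - u) \<or> a = - sqrt (t - u)" for a
    using axis[OF that] pos(3) by (simp add: off)
  have sq: "riesz \<delta> (px\<^sup>2) = 0"
    using ax[of "sqrt (t - u)"] ax[of "- sqrt (t - u)"] u by simp
  have lin: "riesz \<delta> px = 0"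
    using ax[of "sqrt (t - u)"] pos(4) u sq by simp
  have const: "riesz \<delta> 1 = 0"
    using origin off sq by simp
  define e where "e i j = riesz \<delta> (px ^ i * py ^ j)" for i j
  have rec: "4 * e i (j + 3) = of_real (2 * u - t) * e i (j + 1)"
    "4 * e (i + 2) (j + 1) = of_real (2 * u + t) * e i (j + 1)"
    "e (i + 3) j = 3 * e (i + 1) (j + 2) + of_real (t - u) * e (i + 1) j" if "i + j \<le> 3" for i j
    unfolding e_def by (rule moment_recurrences[OF P Q R that])+
  have base: "e 0 0 = 0" "e 1 0 = 0" "e 0 1 = 0" "e 2 0 = 0" "e 1 1 = 0" "e 0 2 = 0" "e 1 2 = 0"
    using const off sq lin by (simp_all add: e_def)
  show "riesz \<delta> (px ^ i * py ^ j) = 0" if "i + j \<le> 6" for i j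
    using recurrences_eq_0[OF rec base that] by (simp only: e_def)
qed

lemma representing_measure_if_line_circle:
  assumes herm: "hermitian_upto 6 \<gamma>" and psd: "psd_mat (moment_matrix \<gamma> 3)"
    and u: "0 < u" "u < t" "t < 2 * u"
    and P: "annihilates \<gamma> 3 (q7_re u t)" and Q: "annihilates \<gamma> 3 (q7_im u t)" and R: "annihilates \<gamma> 3 (line_circle u)"
  shows "\<exists>\<mu>. representing_measure \<gamma> 3 \<mu>"
proof (rule representing_measure_if_lagrange[OF finite_common_zeros[of u t] psd])
  let ?x = "\<lambda>(a, b). point a b" and ?f = "lagrange u t" and ?K = "common_zeros u t"
  show "deg_le 3 (?f k)" for k
    by (rule deg_le_lagrange)
  show interp: "peval (?f k) (?x l) = (if k = l then 1 else 0)" if "k \<in> ?K" "l \<in> ?K" for k l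
    by (rule peval_lagrange[OF u that])
  \<comment> \<open>The error of the cubature formula.\<close>
  define \<delta> where "\<delta> = (\<lambda>i j. \<gamma> i j - (\<Sum>k\<in>?K. riesz \<gamma> (?f k) * (cnj (?x k) ^ i * ?x k ^ j)))"
  have \<delta>: "riesz \<delta> p = riesz \<gamma> p - (\<Sum>k\<in>?K. riesz \<gamma> (?f k) * peval p (?x k))" for p
    unfolding \<delta>_def by (rule riesz_minus_atoms)
  have ann: "annihilates \<delta> 3 p" if "annihilates \<gamma> 3 p" "\<And>k. k \<in> ?K \<Longrightarrow> peval p (?x k) = 0" for p
    using that by (auto simp: annihilates_def \<delta>)
  have sq: "(sqrt (t - u))\<^sup>2 = t - u" "(sqrt ((2 * u + t) / 4))\<^sup>2 = (2 * u + t) / 4" "(sqrt ((2 * u - t) / 4))\<^sup>2 = (2 * u - t) / 4"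
    using u by simp_all
  have zero: "a ^ 3 - 3 * a * b\<^sup>2 - (t - u) * a = 0 \<and> 3 * a\<^sup>2 * b - b ^ 3 - (t + u) * b = 0 \<and> b * (a\<^sup>2 + b\<^sup>2 - u) = 0"
    if "(a, b) \<in> ?K" for a b
  proof -
    have "a = 0 \<and> b = 0 \<or> a\<^sup>2 = t - u \<and> b = 0 \<or> a\<^sup>2 = (2 * u + t) / 4 \<and> b\<^sup>2 = (2 * u - t) / 4"
      using that sq by (auto simp: common_zeros_def)
    moreover have "a ^ 3 - 3 * a * b\<^sup>2 - (t - u) * a = a * (a\<^sup>2 - 3 * b\<^sup>2 - (t - u))"
      "3 * a\<^sup>2 * b - b ^ 3 - (t + u) * b = b * (3 * a\<^sup>2 - b\<^sup>2 - (t + u))"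
      by (simp_all add: algebra_simps power2_eq_square power3_eq_cube)
    ultimately show ?thesis
      by auto
  qed
  have "peval (q7_re u t) (?x k) = 0 \<and> peval (q7_im u t) (?x k) = 0 \<and> peval (line_circle u) (?x k) = 0" if "k \<in> ?K" for k
  proof -
    obtain a b where k: "k = (a, b)"
      by (cases k)
    have "peval (q7_re u t) (?x k) = of_real (a ^ 3 - 3 * a * b\<^sup>2 - (t - u) * a)"
      "peval (q7_im u t) (?x k) = of_real (3 * a\<^sup>2 * b - b ^ 3 - (t + u) * b)"
      "peval (line_circle u) (?x k) = of_real (b * (a\<^sup>2 + b\<^sup>2 - u))"
      by (simp_all add: k q7_re_def q7_im_def line_circle_def)
    then show ?thesis
      using zero[of a b] that unfolding k by (simp only: of_real_0)
  qed
  then have "annihilates \<delta> 3 (q7_re u t)" "annihilates \<delta> 3 (q7_im u t)" "annihilates \<delta> 3 (line_circle u)"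
    using ann P Q R by blast+
  moreover have "riesz \<delta> (?f k) = 0" if "k \<in> ?K" for k
  proof -
    have "(\<Sum>l\<in>?K. riesz \<gamma> (?f l) * peval (?f k) (?x l)) = (\<Sum>l\<in>?K. if l = k then riesz \<gamma> (?f k) else 0)"
      using that by (intro sum.cong) (auto simp: interp)
    then show ?thesis
      unfolding \<delta> using that finite_common_zeros[of u t] by simp
  qed
  ultimately have "riesz \<delta> p = 0" if "deg_le 6 p" for p
    using eq_0_if_lagrange_eq_0[OF u] that by blast
  then show "riesz \<gamma> p = (\<Sum>k\<in>?K. riesz \<gamma> (?f k) * peval p (?x k))" if "deg_le (2 * 3) p" for p
    using that by (simp add: \<delta>)
qed

section \<open>The equivalence\<close>

theorem theorem1p5:
  fixes \<gamma> :: "nat \<Rightarrow> nat \<Rightarrow> complex" and u t :: real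
  assumes "0 < \<gamma> 0 0"
    and "\<And>i j. i + j \<le> 6 \<Longrightarrow> \<gamma> j i = cnj (\<gamma> i j)"
    and "0 < \<bar>u\<bar>" and "\<bar>u\<bar> < t" and "t < 2 * \<bar>u\<bar>"
    and "psd_mat (moment_matrix \<gamma> 3)"
    and "pd_mat (moment_matrix \<gamma> 2)"
    and "column_poly \<gamma> 3 (q7 u t) = 0\<^sub>v (length (monoms 3))"
  defines "cond_i \<equiv> \<exists>\<mu>. representing_measure \<gamma> 3 \<mu>"
    and "cond_ii \<equiv> riesz \<gamma> (qLC u) = 0 \<and> riesz \<gamma> (pz * qLC u) = 0"
    and "cond_iii \<equiv>
          Re (\<gamma> 1 2) - Im (\<gamma> 1 2) = u * (Re (\<gamma> 0 1) - Im (\<gamma> 0 1)) \<and>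
          \<gamma> 2 2 = of_real (t + u) * \<gamma> 1 1 - of_real (2 * u * Im (\<gamma> 0 2))"
    and "cond_iv \<equiv> column_poly \<gamma> 3 (qLC u) = 0\<^sub>v (length (monoms 3))"
  shows "(cond_i \<longleftrightarrow> cond_ii) \<and> (cond_ii \<longleftrightarrow> cond_iii) \<and> (cond_iii \<longleftrightarrow> cond_iv)"
proof -
  have herm: "hermitian_upto 6 \<gamma>"
    unfolding hermitian_upto_def using assms(2) by blast
  have deg_q7: "deg_le 3 (q7 u t)"
    unfolding q7_eq by (intro deg_le_pconst_mult deg_le_add deg_le_q7_re deg_le_q7_im)
  have deg_qLC: "deg_le 3 (qLC u)"
    unfolding qLC_eq by (intro deg_le_pconst_mult deg_le_line_circle)
  have q7: "annihilates \<gamma> 3 (q7 u t)"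
    using assms(8) by (simp only: column_poly_eq_0_iff[OF deg_q7])
  note P = annihilates_q7_re_im(1)[OF herm q7] and Q = annihilates_q7_re_im(2)[OF herm q7]
  have iv: "cond_iv \<longleftrightarrow> annihilates \<gamma> 3 (qLC u)"
    unfolding cond_iv_def by (rule column_poly_eq_0_iff[OF deg_qLC])
  have ii_iv: "cond_ii \<longleftrightarrow> cond_iv"
    unfolding cond_ii_def iv by (rule riesz_qLC_iff_annihilates[OF P Q])
  have ii_iii: "cond_ii \<longleftrightarrow> cond_iii"
    unfolding cond_ii_def cond_iii_def by (rule riesz_qLC_moments[OF herm q7])
  have i_ii: "cond_ii" if "cond_i"
  proof -
    obtain \<mu> where rep: "representing_measure \<gamma> 3 \<mu>"
      using \<open>cond_i\<close> unfolding cond_i_def by blast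
    have AE: "AE z in \<mu>. peval (qLC u) z = 0"
      using annihilates_AE_eq_0[OF rep deg_q7 q7]
      by (rule eventually_mono) (rule q7_zero_imp_qLC_zero[OF assms(3,4)])
    have vanish: "riesz \<gamma> (m * qLC u) = 0" if "deg_le 3 m" for m
    proof -
      have "deg_le (2 * 3) (m * qLC u)"
        using deg_le_mult[OF that deg_qLC] by simp
      then have "riesz \<gamma> (m * qLC u) = integral\<^sup>L \<mu> (peval (m * qLC u))"
        using representing_measure_integral[OF rep] by blast
      also have "\<dots> = 0"
        using AE by (intro integral_eq_zero_AE) (auto elim: eventually_mono)
      finally show ?thesis .
    qed
    show ?thesis
      using vanish[of 1] vanish[of pz] deg_le_mono[OF deg_le_pz, of 3] by (simp add: cond_ii_def)
  qed
  have iv_i: "cond_i" if "cond_iv"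
  proof -
    have R: "annihilates \<gamma> 3 (line_circle u)"
      using that iv by (blast intro: annihilates_line_circle_if_qLC)
    have "0 \<le> 2 * u - t"
      by (rule half_t_le_u[OF herm assms(6,7) P Q R])
    then have "0 < u" "u < t" "t < 2 * u"
      using assms(3-5) by auto
    from representing_measure_if_line_circle[OF herm assms(6) this P Q R] show ?thesis
      unfolding cond_i_def .
  qed
  show ?thesis
    using ii_iv ii_iii i_ii iv_i by blast
qed

end
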